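(* Let $(\gamma_1^{(n)},\gamma_2^{(n)})_{n\ge1}$ be a sequence in $\boldsymbol{\Delta}$ satisfying one of the following: (1) $\gamma_1^{(n)}+\gamma_2^{(n)}\to-3/2$ and, for some fixed $\epsilon>0$, $\gamma_1^{(n)},\gamma_2^{(n)}>-1+\epsilon$ for all $n$; (2) $(\gamma_1^{(n)},\gamma_2^{(n)})\to(-1/2,\gamma)$ or $(\gamma_1^{(n)},\gamma_2^{(n)})\to(\gamma,-1/2)$ for some $\gamma\in(-1,-1/2)$; (3) $\gamma_1^{(n)}\ge\gamma_2^{(n)}$, $(\gamma_1^{(n)},\gamma_2^{(n)})\to(-1/2,-1)$ and $\dfrac{\gamma_1^{(n)}+\gamma_2^{(n)}+3/2}{\gamma_2^{(n)}+1}\to\rho$ for some $\rho\in[0,1]$; (4) $\gamma_1^{(n)}\ge\gamma_2^{(n)}$, $(\gamma_1^{(n)},\gamma_2^{(n)})\to(-1/2,-1/2)$ and $\dfrac{\gamma_1^{(n)}+1/2}{\gamma_2^{(n)}+1/2}\to\rho$ for some $\rho\in[0,1]$. (In each of these cases the processes $Z_{\gamma_1^{(n)},\gamma_2^{(n)}}$ converge weakly in $C[0,1]$.) Then the convergence cannot be strengthened to convergence in $L^2(\Omega)$, nor even to convergence in probability: there is no process $(X(t))_{t\in[0,1]}$ on $\Omega$ such that $Z_{\gamma_1^{(n)},\gamma_2^{(n)}}(t)\to X(t)$ in $L^2(\Omega)$ for every $t\in[0,1]$, nor one such that $Z_{\gamma_1^{(n)},\gamma_2^{(n)}}(t)\to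 X(t)$ in probability for every $t\in[0,1]$.
   Context: Let $\boldsymbol{\Delta}=\{(\gamma_1,\gamma_2): -1<\gamma_1<-1/2,\ -1<\gamma_2<-1/2,\ \gamma_1+\gamma_2>-3/2\}$. Write $u_+^{\gamma}=u^\gamma$ if $u>0$ and $0$ otherwise. For $(\gamma_1,\gamma_2)\in\boldsymbol{\Delta}$, the standardized generalized Rosenblatt process is $$Z_{\gamma_1,\gamma_2}(t)=\frac{A}{2}\int_{\mathbb{R}^2}'\left[\int_0^t\big[(s-x_1)_+^{\gamma_1}(s-x_2)_+^{\gamma_2}+(s-x_1)_+^{\gamma_2}(s-x_2)_+^{\gamma_1}\big]ds\right]B(dx_1)B(dx_2),$$ where $B(\cdot)$ is a single Brownian random measure on $\mathbb{R}$ (Gaussian white noise with Lebesgue control measure) on a probability space $\Omega$, the same for all $(\gamma_1,\gamma_2)$, and $\int'$ denotes the double Wiener-Itô integral (diagonals $x_1=x_2$ excluded). The constant $A=A(\gamma_1,\gamma_2)>0$ is chosen so that $\mathrm{Var}[Z_{\gamma_1,\gamma_2}(1)]=1$; explicitly, with $\mathrm{B}(x,y)=\int_0^1u^{x-1}(1-u)^{y-1}du$ the beta function, $$A(\gamma_1,\gamma_2)=\big[(\gamma_1+\gamma_2+2)(2(\gamma_1+\gamma_2)+3)\big]^{1/2}\big[\mathrm{B}(\gamma_1+1,-\gamma_1-\gamma_2-1)\mathrm{B}(\gamma_2+1,-\gamma_1-\gamma_2-1)+\mathrm{B}(\gamma_1+1,-2\gamma_1-1)\mathrm{B}(\gamma_2+1,-2\gamma_2-1)\big]^{-1/2}.$$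 *)

theory Defs
  imports "HOL-Probability.Probability"
begin

text \<open>
  Gaussian white noise on the real line with Lebesgue control measure, as an independently scattered,
  almost surely \<open>\<sigma>\<close>-additive Gaussian random measure. Only Borel sets of finite Lebesgue measure
  matter; the values of \<open>B\<close> on other sets are unconstrained. Null sets are treated separately
  because \<^const>\<open>normal_density\<close> does not describe the degenerate normal law.
\<close>

locale brownian_random_measure = prob_space M for M :: "'a measure" +
  fixes B :: "real set \<Rightarrow> 'a \<Rightarrow> real"
  assumes random_variable_B:
      "\<And>S. S \<in> sets borel \<Longrightarrow> emeasure lborel S < \<infinity> \<Longrightarrow> random_variable borel (B S)"
    and distributed_B:
      "\<And>S. S \<in> sets borel \<Longrightarrow> emeasure lborel S < \<infinity> \<Longrightarrow> measure lborel S > 0 \<Longrightarrow>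
         distributed M lborel (B S) (normal_density 0 (sqrt (measure lborel S)))"
    and null_B:
      "\<And>S. S \<in> sets borel \<Longrightarrow> emeasure lborel S = 0 \<Longrightarrow> AE \<omega> in M. B S \<omega> = 0"
    and indep_B:
      "\<And>(k::nat) S. (\<And>i. i < k \<Longrightarrow> S i \<in> sets borel \<and> emeasure lborel (S i) < \<infinity>) \<Longrightarrow>
         disjoint_family_on S {..<k} \<Longrightarrow> indep_vars (\<lambda>_. borel) (\<lambda>i. B (S i)) {..<k}"
    and sigma_additive_B:
      "\<And>S :: nat \<Rightarrow> real set. range S \<subseteq> sets borel \<Longrightarrow> disjoint_family S \<Longrightarrow>
         emeasure lborel (\<Union>i. S i) < \<infinity> \<Longrightarrow>
         AE \<omega> in M. (\<lambda>i. B (S i) \<omega>) sums B (\<Union>i. S i) \<omega>"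

text \<open>
  The \<open>L\<^sup>2\<close> distance is a nonnegative integral, so it is \<open>\<infinity>\<close>, rather than \<open>0\<close>, when the
  difference is not square integrable. Membership of the limit in \<open>L\<^sup>2\<close> is automatic
  whenever the approximating functions belong to \<open>L\<^sup>2\<close>.
\<close>

definition tendsto_L2 :: "'b measure \<Rightarrow> (nat \<Rightarrow> 'b \<Rightarrow> real) \<Rightarrow> ('b \<Rightarrow> real) \<Rightarrow> bool" where
  "tendsto_L2 N f g \<longleftrightarrow>
     (\<forall>n. f n \<in> borel_measurable N) \<and> g \<in> borel_measurable N \<and>
     (\<lambda>n. \<integral>\<^sup>+ x. ennreal ((f n x - g x)\<^sup>2) \<partial>N) \<longlonglongrightarrow> 0"

definition tendsto_in_prob :: "'b measure \<Rightarrow> (nat \<Rightarrow> 'b \<Rightarrow> real) \<Rightarrow> ('b \<Rightarrow> real) \<Rightarrow> bool" where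
  "tendsto_in_prob N f g \<longleftrightarrow>
     (\<forall>n. f n \<in> borel_measurable N) \<and> g \<in> borel_measurable N \<and>
     (\<forall>\<epsilon>>0. (\<lambda>n. measure N {x \<in> space N. \<bar>f n x - g x\<bar> > \<epsilon>}) \<longlonglongrightarrow> 0)"

text \<open>
  The triple \<open>(k, S, c)\<close> encodes the step function with value \<open>c i j\<close> on \<open>S i \<times> S j\<close> for
  \<open>i, j < k\<close>; it vanishes on all the diagonal blocks \<open>S i \<times> S i\<close>.
\<close>

definition off_diagonal_step :: "nat \<Rightarrow> (nat \<Rightarrow> real set) \<Rightarrow> (nat \<Rightarrow> nat \<Rightarrow> real) \<Rightarrow> bool" where
  "off_diagonal_step k S c \<longleftrightarrow>
     (\<forall>i<k. S i \<in> sets borel \<and> emeasure lborel (S i) < \<infinity>) \<and>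
     disjoint_family_on S {..<k} \<and> (\<forall>i<k. c i i = 0)"

definition step_function ::
    "nat \<Rightarrow> (nat \<Rightarrow> real set) \<Rightarrow> (nat \<Rightarrow> nat \<Rightarrow> real) \<Rightarrow> real \<times> real \<Rightarrow> real" where
  "step_function k S c = (\<lambda>(x\<^sub>1, x\<^sub>2).
     \<Sum>i<k. \<Sum>j<k. c i j * indicator (S i) x\<^sub>1 * indicator (S j) x\<^sub>2)"

definition step_integral ::
    "(real set \<Rightarrow> 'a \<Rightarrow> real) \<Rightarrow> nat \<Rightarrow> (nat \<Rightarrow> real set) \<Rightarrow> (nat \<Rightarrow> nat \<Rightarrow> real) \<Rightarrow> 'a \<Rightarrow> real" where
  "step_integral B k S c = (\<lambda>\<omega>. \<Sum>i<k. \<Sum>j<k. c i j * B (S i) \<omega> * B (S j) \<omega>)"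

text \<open>
  \<open>has_double_wiener_integral M B f Y\<close>: the random variable \<open>Y\<close> is a version of the double
  Wiener--Ito integral of \<open>f \<in> L\<^sup>2(\<real>\<^sup>2)\<close> with respect to \<open>B\<close>, that is, the \<open>L\<^sup>2\<close> limit of the
  elementary integrals of off-diagonal step functions converging to \<open>f\<close> in \<open>L\<^sup>2(\<real>\<^sup>2)\<close>. It is a
  relation because the integral is determined only up to almost sure equality.
\<close>

definition has_double_wiener_integral ::
    "'a measure \<Rightarrow> (real set \<Rightarrow> 'a \<Rightarrow> real) \<Rightarrow> (real \<times> real \<Rightarrow> real) \<Rightarrow> ('a \<Rightarrow> real) \<Rightarrow> bool" where
  "has_double_wiener_integral M B f Y \<longleftrightarrow>
     (\<exists>k S c. (\<forall>m. off_diagonal_step (k m) (S m) (c m)) \<and>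
        tendsto_L2 lborel (\<lambda>m. step_function (k m) (S m) (c m)) f \<and>
        tendsto_L2 M (\<lambda>m. step_integral B (k m) (S m) (c m)) Y)"

definition Rosenblatt_Delta :: "(real \<times> real) set" where
  "Rosenblatt_Delta =
     {(\<gamma>\<^sub>1, \<gamma>\<^sub>2). -1 < \<gamma>\<^sub>1 \<and> \<gamma>\<^sub>1 < -1/2 \<and> -1 < \<gamma>\<^sub>2 \<and> \<gamma>\<^sub>2 < -1/2 \<and> \<gamma>\<^sub>1 + \<gamma>\<^sub>2 > -3/2}"

definition pos_powr :: "real \<Rightarrow> real \<Rightarrow> real" where
  "pos_powr u \<gamma> = (if u > 0 then u powr \<gamma> else 0)"

text \<open>
  On the null set \<open>x\<^sub>1 = x\<^sub>2\<close> the integral over \<open>s\<close> may diverge; the Bochner integral then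
  has the value \<open>0\<close>.
\<close>

definition Rosenblatt_kernel :: "real \<Rightarrow> real \<Rightarrow> real \<Rightarrow> real \<times> real \<Rightarrow> real" where
  "Rosenblatt_kernel \<gamma>\<^sub>1 \<gamma>\<^sub>2 t = (\<lambda>(x\<^sub>1, x\<^sub>2).
     LINT s:{0..t}|lborel.
       pos_powr (s - x\<^sub>1) \<gamma>\<^sub>1 * pos_powr (s - x\<^sub>2) \<gamma>\<^sub>2 + pos_powr (s - x\<^sub>1) \<gamma>\<^sub>2 * pos_powr (s - x\<^sub>2) \<gamma>\<^sub>1)"

text \<open>The normalisation making the variance at time \<open>1\<close> equal to \<open>1\<close>.\<close>

definition Rosenblatt_A :: "real \<Rightarrow> real \<Rightarrow> real" where
  "Rosenblatt_A \<gamma>\<^sub>1 \<gamma>\<^sub>2 =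
     sqrt ((\<gamma>\<^sub>1 + \<gamma>\<^sub>2 + 2) * (2 * (\<gamma>\<^sub>1 + \<gamma>\<^sub>2) + 3)) /
     sqrt (Beta (\<gamma>\<^sub>1 + 1) (- \<gamma>\<^sub>1 - \<gamma>\<^sub>2 - 1) * Beta (\<gamma>\<^sub>2 + 1) (- \<gamma>\<^sub>1 - \<gamma>\<^sub>2 - 1)
           + Beta (\<gamma>\<^sub>1 + 1) (- 2 * \<gamma>\<^sub>1 - 1) * Beta (\<gamma>\<^sub>2 + 1) (- 2 * \<gamma>\<^sub>2 - 1))"

text \<open>\<open>Z\<close> is an arbitrary version of the process: for each \<open>t\<close> any version of the integral is allowed.\<close>

definition generalized_Rosenblatt ::
    "'a measure \<Rightarrow> (real set \<Rightarrow> 'a \<Rightarrow> real) \<Rightarrow> real \<Rightarrow> real \<Rightarrow> (real \<Rightarrow> 'a \<Rightarrow> real) \<Rightarrow> bool" where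
  "generalized_Rosenblatt M B \<gamma>\<^sub>1 \<gamma>\<^sub>2 Z \<longleftrightarrow>
     (\<forall>t\<ge>0. \<exists>Y. has_double_wiener_integral M B (Rosenblatt_kernel \<gamma>\<^sub>1 \<gamma>\<^sub>2 t) Y \<and>
        (\<forall>\<omega>\<in>space M. Z t \<omega> = Rosenblatt_A \<gamma>\<^sub>1 \<gamma>\<^sub>2 / 2 * Y \<omega>))"

end

theory Submission
  imports Defs
begin

text \<open>
  The idea is that \<open>Z n 1\<close> is a double Wiener integral whose kernel has a fixed \<open>L\<^sup>2\<close> norm but tends
  to \<open>0\<close> almost everywhere: the mass of the kernel escapes, so that the law of \<open>Z n 1\<close> may
  converge while the random variable itself can not. The single time \<open>t = 1\<close> gives the contradiction.

  Let \<open>F n\<close> be the kernel of \<open>Z n 1\<close>. Carrying out the \<open>x\<close>-integrals first, by the beta integral over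
  a half line, one obtains \<open>\<parallel>F n\<parallel>\<^sup>2 = 1/2\<close> (\<open>Rosenblatt_kernel_normalised\<close>). On the other hand, off
  the diagonal the kernel without its constant is at most
  \<open>C(x\<^sub>1, x\<^sub>2) (1 / (\<gamma>\<^sub>1 + 1) + 1 / (\<gamma>\<^sub>2 + 1))\<close>, and in each of the four cases \<open>A(\<gamma>\<^sub>1, \<gamma>\<^sub>2)\<close> is
  of smaller order than both \<open>\<gamma>\<^sub>1 + 1\<close> and \<open>\<gamma>\<^sub>2 + 1\<close> (\<open>Rosenblatt_A_over_exponents_tendsto_0\<close>); hence
  \<open>F n \<longlonglongrightarrow> 0\<close> off the diagonal.

  Fatou's lemma then gives, for each \<open>n\<close>, arbitrarily large \<open>m\<close> with \<open>\<parallel>F n - F m\<parallel>\<^sup>2 \<ge> 1/4\<close>. To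
  contradict the Cauchy property in probability, a lower bound for \<open>L\<^sup>2\<close> norms has to become a lower
  bound for probabilities. In the second Wiener chaos this is possible because the fourth moment is
  bounded by \<open>27\<close> times the square of the second one: this is proved for
  off-diagonal quadratic forms in independent Gaussian variables by adding one variable at a time
  (\<open>quadratic_form_moments\<close>), and the Paley--Zygmund inequality turns it into
  \<open>P(\<bar>Y\<bar> > \<surd>u / 4) \<ge> 1/216\<close> for each integral \<open>Y\<close> of a symmetric kernel with squared norm at least
  \<open>u\<close> (\<open>double_wiener_integral_tail\<close>). The estimate is applied to the difference of two integrals,
  which is itself a double Wiener integral since two step functions have a common refinement
  (\<open>has_double_wiener_integral_lincomb\<close>).

  Convergence in \<open>L\<^sup>2\<close> implies convergence in probability, so the second negative statement contains
  the first.
\<close>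

section \<open>Second and fourth moments of quadratic forms in independent variables\<close>

lemma (in prob_space) integrable_power4_imp:
  fixes X Y :: "'a \<Rightarrow> real"
  assumes [measurable]: "X \<in> borel_measurable M" "Y \<in> borel_measurable M"
    and X: "integrable M (\<lambda>\<omega>. X \<omega> ^ 4)" and Y: "integrable M (\<lambda>\<omega>. Y \<omega> ^ 4)"
    and h[measurable]: "(\<lambda>\<omega>. h \<omega> :: real) \<in> borel_measurable M"
    and le: "\<And>\<omega>. \<bar>h \<omega>\<bar> \<le> 1 + X \<omega> ^ 4 + Y \<omega> ^ 4"
  shows "integrable M h"
proof (rule Bochner_Integration.integrable_bound)
  show "integrable M (\<lambda>\<omega>. 1 + X \<omega> ^ 4 + Y \<omega> ^ 4)" using X Y by auto
  show "AE x in M. norm (h x) \<le> norm (1 + X x ^ 4 + Y x ^ 4)"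
    using le by (auto intro!: order_trans[OF le])
qed simp

lemma monomial_le_quartic:
  fixes a b :: real
  assumes "i + j \<le> 4"
  shows "\<bar>a ^ i * b ^ j\<bar> \<le> 1 + a ^ 4 + b ^ 4"
proof -
  define m where "m = max 1 (max \<bar>a\<bar> \<bar>b\<bar>)"
  have "\<bar>a ^ i * b ^ j\<bar> = \<bar>a\<bar> ^ i * \<bar>b\<bar> ^ j" by (simp add: abs_mult power_abs)
  also have "\<dots> \<le> m ^ i * m ^ j" by (intro mult_mono power_mono) (auto simp: m_def)
  also have "\<dots> \<le> m ^ 4"
    unfolding power_add[symmetric] using assms by (intro power_increasing) (auto simp: m_def)
  also have "m ^ 4 \<le> 1 + a ^ 4 + b ^ 4"
  proof -
    have "m = 1 \<or> m = \<bar>a\<bar> \<or> m = \<bar>b\<bar>" unfolding m_def by linarith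
    then have "m ^ 4 = 1 \<or> m ^ 4 = a ^ 4 \<or> m ^ 4 = b ^ 4" by (elim disjE) simp_all
    moreover have "0 \<le> a ^ 4" "0 \<le> b ^ 4" by simp_all
    ultimately show ?thesis by (elim disjE) linarith+
  qed
  finally show ?thesis .
qed

lemma (in prob_space) indep_mult_expectation:
  fixes f g :: "'b \<Rightarrow> real"
  assumes ind: "indep_var N X N' Y"
    and [measurable]: "f \<in> borel_measurable N" "g \<in> borel_measurable N'"
    and "integrable M (\<lambda>\<omega>. f (X \<omega>))" "integrable M (\<lambda>\<omega>. g (Y \<omega>))"
  shows "integrable M (\<lambda>\<omega>. f (X \<omega>) * g (Y \<omega>))"
    and "expectation (\<lambda>\<omega>. f (X \<omega>) * g (Y \<omega>)) = expectation (\<lambda>\<omega>. f (X \<omega>)) * expectation (\<lambda>\<omega>. g (Y \<omega>))"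
proof -
  have "indep_var borel (f \<circ> X) borel (g \<circ> Y)"
    using ind by (rule indep_var_compose) auto
  then have i: "indep_var borel (\<lambda>\<omega>. f (X \<omega>)) borel (\<lambda>\<omega>. g (Y \<omega>))" by (simp add: o_def)
  show "integrable M (\<lambda>\<omega>. f (X \<omega>) * g (Y \<omega>))"
    using i assms by (intro indep_var_integrable)
  show "expectation (\<lambda>\<omega>. f (X \<omega>) * g (Y \<omega>)) = expectation (\<lambda>\<omega>. f (X \<omega>)) * expectation (\<lambda>\<omega>. g (Y \<omega>))"
    using i assms by (intro indep_var_lebesgue_integral)
qed

text \<open>
  The step that adds one variable to a form: if \<open>x\<close> has vanishing first and third moments and is
  independent of \<open>(p, l)\<close>, then all odd powers of \<open>x\<close> in the binomial expansion of
  \<open>(p + x l)\<^sup>4\<close> integrate to \<open>0\<close>.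
\<close>

lemma (in prob_space) indep_step_moments:
  fixes X Y :: "'a \<Rightarrow> 'b" and p l x :: "'b \<Rightarrow> real"
  assumes ind: "indep_var N X N' Y"
    and [measurable]: "p \<in> borel_measurable N" "l \<in> borel_measurable N" "x \<in> borel_measurable N'"
    and iP: "integrable M (\<lambda>\<omega>. p (X \<omega>) ^ 4)" and iL: "integrable M (\<lambda>\<omega>. l (X \<omega>) ^ 4)"
    and i\<xi>: "integrable M (\<lambda>\<omega>. x (Y \<omega>) ^ 4)"
    and odd: "expectation (\<lambda>\<omega>. x (Y \<omega>)) = 0" "expectation (\<lambda>\<omega>. x (Y \<omega>) ^ 3) = 0"
  shows "integrable M (\<lambda>\<omega>. (p (X \<omega>) + x (Y \<omega>) * l (X \<omega>)) ^ 4)"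
    and "expectation (\<lambda>\<omega>. (p (X \<omega>) + x (Y \<omega>) * l (X \<omega>)) ^ 2)
      = expectation (\<lambda>\<omega>. p (X \<omega>) ^ 2) + expectation (\<lambda>\<omega>. x (Y \<omega>) ^ 2) * expectation (\<lambda>\<omega>. l (X \<omega>) ^ 2)"
    and "expectation (\<lambda>\<omega>. (p (X \<omega>) + x (Y \<omega>) * l (X \<omega>)) ^ 4)
      = expectation (\<lambda>\<omega>. p (X \<omega>) ^ 4)
        + 6 * expectation (\<lambda>\<omega>. x (Y \<omega>) ^ 2) * expectation (\<lambda>\<omega>. p (X \<omega>) ^ 2 * l (X \<omega>) ^ 2)
        + expectation (\<lambda>\<omega>. x (Y \<omega>) ^ 4) * expectation (\<lambda>\<omega>. l (X \<omega>) ^ 4)"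
proof -
  define P L \<xi> where PL_defs: "P = (\<lambda>\<omega>. p (X \<omega>))" "L = (\<lambda>\<omega>. l (X \<omega>))" "\<xi> = (\<lambda>\<omega>. x (Y \<omega>))"
  have [measurable]: "X \<in> measurable M N" "Y \<in> measurable M N'"
    using ind by (auto dest: indep_var_rv1 indep_var_rv2)
  have mP[measurable]: "P \<in> borel_measurable M" and mL[measurable]: "L \<in> borel_measurable M"
    and m\<xi>[measurable]: "\<xi> \<in> borel_measurable M"
    unfolding PL_defs by measurable
  have PL: "p (X \<omega>) = P \<omega>" "l (X \<omega>) = L \<omega>" "x (Y \<omega>) = \<xi> \<omega>" for \<omega>
    by (simp_all add: PL_defs)
  note iP = iP[unfolded PL] and iL = iL[unfolded PL] and i\<xi> = i\<xi>[unfolded PL] and odd = odd[unfolded PL]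
  have mono: "integrable M (\<lambda>\<omega>. P \<omega> ^ i * L \<omega> ^ j)" if "i + j \<le> 4" for i j
    by (rule integrable_power4_imp[OF mP mL iP iL _ monomial_le_quartic[OF that]]) measurable
  have pw: "integrable M (\<lambda>\<omega>. P \<omega> ^ 2)" "integrable M (\<lambda>\<omega>. L \<omega> ^ 2)"
    "integrable M (\<lambda>\<omega>. P \<omega> ^ 3 * L \<omega>)" "integrable M (\<lambda>\<omega>. P \<omega> ^ 2 * L \<omega> ^ 2)"
    "integrable M (\<lambda>\<omega>. P \<omega> * L \<omega> ^ 3)" "integrable M (\<lambda>\<omega>. P \<omega> * L \<omega>)"
    using mono[of 2 0] mono[of 0 2] mono[of 3 1] mono[of 2 2] mono[of 1 3] mono[of 1 1] by simp_all
  have mono\<xi>: "integrable M (\<lambda>\<omega>. \<xi> \<omega> ^ i * \<xi> \<omega> ^ 0)" if "i + 0 \<le> 4" for i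
    by (rule integrable_power4_imp[OF m\<xi> m\<xi> i\<xi> i\<xi> _ monomial_le_quartic[OF that]]) measurable
  have x: "integrable M \<xi>" "integrable M (\<lambda>\<omega>. \<xi> \<omega> ^ 2)" "integrable M (\<lambda>\<omega>. \<xi> \<omega> ^ 3)"
    using mono\<xi>[of 1] mono\<xi>[of 2] mono\<xi>[of 3] by simp_all
  have e1: "integrable M (\<lambda>\<omega>. P \<omega> * L \<omega> * \<xi> \<omega>)" "expectation (\<lambda>\<omega>. P \<omega> * L \<omega> * \<xi> \<omega>) = 0"
    using indep_mult_expectation[OF ind, of "\<lambda>z. p z * l z" "\<lambda>z. x z", unfolded PL] pw x odd by simp_all
  have e2: "integrable M (\<lambda>\<omega>. L \<omega> ^ 2 * \<xi> \<omega> ^ 2)"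
     "expectation (\<lambda>\<omega>. L \<omega>^2 * \<xi> \<omega>^2) = expectation (\<lambda>\<omega>. L \<omega> ^ 2) * expectation (\<lambda>\<omega>. \<xi> \<omega> ^ 2)"
    using indep_mult_expectation[OF ind, of "\<lambda>z. l z^2" "\<lambda>z. x z^2", unfolded PL] pw x odd by simp_all
  have e3: "integrable M (\<lambda>\<omega>. P \<omega> ^ 3 * L \<omega> * \<xi> \<omega>)" "expectation (\<lambda>\<omega>. P \<omega> ^ 3 * L \<omega> * \<xi> \<omega>) = 0"
    using indep_mult_expectation[OF ind, of "\<lambda>z. p z ^ 3 * l z" "\<lambda>z. x z", unfolded PL] pw x odd by simp_all
  have e4: "integrable M (\<lambda>\<omega>. P \<omega> * L \<omega> ^ 3 * \<xi> \<omega> ^ 3)" "expectation (\<lambda>\<omega>. P \<omega> * L \<omega> ^ 3 * \<xi> \<omega> ^ 3) = 0"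
    using indep_mult_expectation[OF ind, of "\<lambda>z. p z * l z ^ 3" "\<lambda>z. x z ^ 3", unfolded PL] pw x odd by simp_all
  have e5: "integrable M (\<lambda>\<omega>. P \<omega> ^ 2 * L \<omega> ^ 2 * \<xi> \<omega> ^ 2)"
    "expectation (\<lambda>\<omega>. P \<omega> ^ 2 * L \<omega> ^ 2 * \<xi> \<omega> ^ 2) = expectation (\<lambda>\<omega>. P \<omega> ^ 2 * L \<omega> ^ 2) * expectation (\<lambda>\<omega>. \<xi> \<omega> ^ 2)"
    using indep_mult_expectation[OF ind, of "\<lambda>z. p z ^ 2 * l z ^ 2" "\<lambda>z. x z ^ 2", unfolded PL] pw x odd by simp_all
  have e6: "integrable M (\<lambda>\<omega>. L \<omega> ^ 4 * \<xi> \<omega> ^ 4)"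
    "expectation (\<lambda>\<omega>. L \<omega> ^ 4 * \<xi> \<omega> ^ 4) = expectation (\<lambda>\<omega>. L \<omega> ^ 4) * expectation (\<lambda>\<omega>. \<xi> \<omega> ^ 4)"
    using indep_mult_expectation[OF ind, of "\<lambda>z. l z ^ 4" "\<lambda>z. x z ^ 4", unfolded PL] iL i\<xi> by simp_all
  have q4: "(\<lambda>\<omega>. (P \<omega> + \<xi> \<omega> * L \<omega>) ^ 4) = (\<lambda>\<omega>. P \<omega> ^ 4 + 4 * (P \<omega> ^ 3 * L \<omega> * \<xi> \<omega>)
      + 6 * (P \<omega> ^ 2 * L \<omega> ^ 2 * \<xi> \<omega> ^ 2) + 4 * (P \<omega> * L \<omega> ^ 3 * \<xi> \<omega> ^ 3) + L \<omega> ^ 4 * \<xi> \<omega> ^ 4)"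
    by (rule ext) algebra
  have q2: "(\<lambda>\<omega>. (P \<omega> + \<xi> \<omega> * L \<omega>) ^ 2) = (\<lambda>\<omega>. P \<omega> ^ 2 + 2 * (P \<omega> * L \<omega> * \<xi> \<omega>) + L \<omega> ^ 2 * \<xi> \<omega> ^ 2)"
    by (rule ext) algebra
  have r: "integrable M (\<lambda>\<omega>. (P \<omega> + \<xi> \<omega> * L \<omega>) ^ 4)"
    unfolding q4 using e3 e4 e5 e6 iP by auto
  then show "integrable M (\<lambda>\<omega>. (p (X \<omega>) + x (Y \<omega>) * l (X \<omega>)) ^ 4)" by (simp add: PL_defs)
  have "expectation (\<lambda>\<omega>. (P \<omega> + \<xi> \<omega> * L \<omega>) ^ 2)
      = expectation (\<lambda>\<omega>. P \<omega> ^ 2) + expectation (\<lambda>\<omega>. \<xi> \<omega> ^ 2) * expectation (\<lambda>\<omega>. L \<omega> ^ 2)"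
    unfolding q2 using e1 e2 pw by simp
  then show "expectation (\<lambda>\<omega>. (p (X \<omega>) + x (Y \<omega>) * l (X \<omega>)) ^ 2)
      = expectation (\<lambda>\<omega>. p (X \<omega>) ^ 2) + expectation (\<lambda>\<omega>. x (Y \<omega>) ^ 2) * expectation (\<lambda>\<omega>. l (X \<omega>) ^ 2)"
    by (simp add: PL_defs)
  have "expectation (\<lambda>\<omega>. (P \<omega> + \<xi> \<omega> * L \<omega>) ^ 4)
      = expectation (\<lambda>\<omega>. P \<omega> ^ 4)
        + 6 * expectation (\<lambda>\<omega>. \<xi> \<omega> ^ 2) * expectation (\<lambda>\<omega>. P \<omega> ^ 2 * L \<omega> ^ 2)
        + expectation (\<lambda>\<omega>. \<xi> \<omega> ^ 4) * expectation (\<lambda>\<omega>. L \<omega> ^ 4)"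
    unfolding q4 using e3 e4 e5 e6 iP by simp
  then show "expectation (\<lambda>\<omega>. (p (X \<omega>) + x (Y \<omega>) * l (X \<omega>)) ^ 4)
      = expectation (\<lambda>\<omega>. p (X \<omega>) ^ 4)
        + 6 * expectation (\<lambda>\<omega>. x (Y \<omega>) ^ 2) * expectation (\<lambda>\<omega>. p (X \<omega>) ^ 2 * l (X \<omega>) ^ 2)
        + expectation (\<lambda>\<omega>. x (Y \<omega>) ^ 4) * expectation (\<lambda>\<omega>. l (X \<omega>) ^ 4)"
    by (simp add: PL_defs)
qed

text \<open>
  The Cauchy--Schwarz inequality for \<open>P\<^sup>2\<close> and \<open>L\<^sup>2\<close>, which controls the mixed term left by
  \<open>indep_step_moments\<close>.
\<close>

lemma (in prob_space) expectation_square_mult_le: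
  fixes P L :: "'a \<Rightarrow> real"
  assumes mP[measurable]: "P \<in> borel_measurable M" and mL[measurable]: "L \<in> borel_measurable M"
    and iP: "integrable M (\<lambda>\<omega>. P \<omega> ^ 4)" and iL: "integrable M (\<lambda>\<omega>. L \<omega> ^ 4)"
    and a: "expectation (\<lambda>\<omega>. P \<omega> ^ 4) \<le> a^2" and b: "expectation (\<lambda>\<omega>. L \<omega> ^ 4) \<le> b^2"
    and "0 \<le> a" "0 \<le> b"
  shows "expectation (\<lambda>\<omega>. P \<omega> ^ 2 * L \<omega> ^ 2) \<le> a * b"
proof -
  have i: "integrable M (\<lambda>\<omega>. P \<omega> ^ 2 * L \<omega> ^ 2)"
    by (rule integrable_power4_imp[OF mP mL iP iL _ monomial_le_quartic[of 2 2]]) simp_all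
  have e: "0 \<le> expectation (\<lambda>\<omega>. P \<omega> ^ 2 * L \<omega> ^ 2)" by (rule Bochner_Integration.integral_nonneg) simp
  have pow: "ennreal (y ^ 2) ^ 2 = ennreal (y ^ 4)" for y :: real
    by (subst ennreal_power) simp_all
  have "ennreal (expectation (\<lambda>\<omega>. P \<omega> ^ 2 * L \<omega> ^ 2) ^ 2) = ennreal (expectation (\<lambda>\<omega>. P \<omega> ^ 2 * L \<omega> ^ 2)) ^ 2"
    using e by (rule ennreal_power[symmetric])
  also have "\<dots> = (\<integral>\<^sup>+\<omega>. ennreal (P \<omega> ^ 2 * L \<omega> ^ 2) \<partial>M) ^ 2"
    by (subst nn_integral_eq_integral[OF i]) simp_all
  also have "\<dots> = (\<integral>\<^sup>+\<omega>. ennreal (P \<omega> ^ 2) * ennreal (L \<omega> ^ 2) \<partial>M) ^ 2"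
    by (simp only: ennreal_mult zero_le_power2)
  also have "\<dots> \<le> (\<integral>\<^sup>+\<omega>. ennreal (P \<omega> ^ 2) ^ 2 \<partial>M) * (\<integral>\<^sup>+\<omega>. ennreal (L \<omega> ^ 2) ^ 2 \<partial>M)"
    by (rule Cauchy_Schwarz_nn_integral) measurable
  also have "\<dots> = ennreal (expectation (\<lambda>\<omega>. P \<omega> ^ 4)) * ennreal (expectation (\<lambda>\<omega>. L \<omega> ^ 4))"
    unfolding pow using nn_integral_eq_integral[OF iP] nn_integral_eq_integral[OF iL] by simp
  also have "\<dots> \<le> ennreal (a^2) * ennreal (b^2)"
    by (intro mult_mono ennreal_leI a b) simp_all
  also have "\<dots> = ennreal ((a*b)^2)" by (simp only: ennreal_mult[symmetric] power_mult_distrib zero_le_power2)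
  finally have "expectation (\<lambda>\<omega>. P \<omega> ^ 2 * L \<omega> ^ 2) ^ 2 \<le> (a*b)^2"
    by (rule ennreal_le_iff[THEN iffD1, rotated]) simp
  then show ?thesis by (rule power2_le_imp_le) (use \<open>0 \<le> a\<close> \<open>0 \<le> b\<close> in simp)
qed

lemma (in prob_space) indep_vars_split_last:
  fixes X :: "nat \<Rightarrow> 'a \<Rightarrow> real"
  assumes "indep_vars (\<lambda>_. borel) X {..<Suc k}"
  shows "indep_var (PiM {..<k} (\<lambda>_. borel)) (\<lambda>\<omega>. restrict (\<lambda>i. X i \<omega>) {..<k})
           (PiM {k} (\<lambda>_. borel)) (\<lambda>\<omega>. restrict (\<lambda>i. X i \<omega>) {k})"
  using assms by (rule indep_var_restrict) auto

text \<open>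
  These are the moments of a centred Gaussian variable. The hypotheses prescribe moments instead of
  laws, so that variables vanishing almost surely, which arise from null sets, are included.
\<close>

lemma (in prob_space) linear_form_moments:
  fixes X :: "nat \<Rightarrow> 'a \<Rightarrow> real"
  assumes "indep_vars (\<lambda>_. borel) X {..<k}"
    and "\<And>i. i < k \<Longrightarrow> integrable M (\<lambda>\<omega>. X i \<omega> ^ 4)"
    and "\<And>i. i < k \<Longrightarrow> expectation (X i) = 0"
    and "\<And>i. i < k \<Longrightarrow> expectation (\<lambda>\<omega>. X i \<omega> ^ 2) = s i"
    and "\<And>i. i < k \<Longrightarrow> expectation (\<lambda>\<omega>. X i \<omega> ^ 3) = 0"
    and "\<And>i. i < k \<Longrightarrow> expectation (\<lambda>\<omega>. X i \<omega> ^ 4) = 3 * s i ^ 2"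
  shows "integrable M (\<lambda>\<omega>. (\<Sum>i<k. a i * X i \<omega>) ^ 4) \<and>
    expectation (\<lambda>\<omega>. (\<Sum>i<k. a i * X i \<omega>) ^ 2) = (\<Sum>i<k. a i ^ 2 * s i) \<and>
    expectation (\<lambda>\<omega>. (\<Sum>i<k. a i * X i \<omega>) ^ 4) = 3 * (\<Sum>i<k. a i ^ 2 * s i) ^ 2"
  using assms
proof (induction k)
  case 0
  then show ?case by simp
next
  case (Suc k)
  define R where "R \<omega> = restrict (\<lambda>i. X i \<omega>) {..<k}" for \<omega>
  define T where "T \<omega> = restrict (\<lambda>i. X i \<omega>) {k}" for \<omega>
  define p where "p z = (\<Sum>i<k. a i * z i)" for z :: "nat \<Rightarrow> real"
  have pR: "p (R \<omega>) = (\<Sum>i<k. a i * X i \<omega>)" and xT: "T \<omega> k = X k \<omega>" for \<omega>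
    by (simp_all add: p_def R_def T_def)
  have "indep_vars (\<lambda>_. borel) X {..<k}"
    using Suc.prems(1) by (rule indep_vars_subset) auto
  then have IH: "integrable M (\<lambda>\<omega>. p (R \<omega>) ^ 4)"
      "expectation (\<lambda>\<omega>. p (R \<omega>) ^ 2) = (\<Sum>i<k. a i ^ 2 * s i)"
      "expectation (\<lambda>\<omega>. p (R \<omega>) ^ 4) = 3 * (\<Sum>i<k. a i ^ 2 * s i) ^ 2"
    unfolding pR using Suc.IH Suc.prems(2-) by simp_all
  have ind: "indep_var (PiM {..<k} (\<lambda>_. borel)) R (PiM {k} (\<lambda>_. borel)) T"
    unfolding R_def T_def using Suc.prems(1) by (rule indep_vars_split_last)
  have m: "p \<in> borel_measurable (PiM {..<k} (\<lambda>_. borel))" unfolding p_def by measurable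
  have mk: "(\<lambda>z. z k) \<in> borel_measurable (PiM {k} (\<lambda>_. borel :: real measure))" by measurable
  note step = indep_step_moments[where p=p and l="\<lambda>_. a k" and x="\<lambda>z. z k" and X=R and Y=T, unfolded xT, OF ind m _ mk IH(1) _ Suc.prems(2)[OF lessI] Suc.prems(3)[OF lessI] Suc.prems(5)[OF lessI], simplified]
  have eq: "(\<Sum>i<Suc k. a i * X i \<omega>) = p (R \<omega>) + X k \<omega> * a k" for \<omega>
    by (simp add: pR)
  have 2: "expectation (\<lambda>\<omega>. X k \<omega> ^ 2) = s k" "expectation (\<lambda>\<omega>. X k \<omega> ^ 4) = 3 * s k ^ 2"
    using Suc.prems(4,6) by simp_all
  show ?case
    unfolding eq step(2,3) 2 IH using step(1)
    by (simp add: IH prob_space) (simp add: power2_eq_square power4_eq_xxxx algebra_simps)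
qed

text \<open>
  The fourth moment bound for the second chaos. As the diagonal coefficients vanish, the form in
  \<open>k + 1\<close> variables is \<open>p + X\<^sub>k l\<close> with \<open>p\<close> a quadratic and \<open>l\<close> a linear form in the first \<open>k\<close>
  variables. With \<open>q = E p\<^sup>2\<close>, \<open>r = E l\<^sup>2\<close> and \<open>s\<close> the variance of \<open>X\<^sub>k\<close>, the fourth moment is at most
  \<open>27 q\<^sup>2 + 6 s \<surd>(27 q\<^sup>2 \<cdot> 3 r\<^sup>2) + 9 s\<^sup>2 r\<^sup>2 \<le> 27 (q + s r)\<^sup>2\<close>. The constant \<open>27\<close> is the least
  for which the middle term is absorbed: \<open>6 \<surd>(3 C) \<le> 2 C\<close> means \<open>C \<ge> 27\<close>.
\<close>

lemma (in prob_space) quadratic_form_moments: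
  fixes X :: "nat \<Rightarrow> 'a \<Rightarrow> real"
  assumes "indep_vars (\<lambda>_. borel) X {..<k}"
    and "\<And>i. i < k \<Longrightarrow> integrable M (\<lambda>\<omega>. X i \<omega> ^ 4)"
    and "\<And>i. i < k \<Longrightarrow> expectation (X i) = 0"
    and "\<And>i. i < k \<Longrightarrow> expectation (\<lambda>\<omega>. X i \<omega> ^ 2) = s i"
    and "\<And>i. i < k \<Longrightarrow> expectation (\<lambda>\<omega>. X i \<omega> ^ 3) = 0"
    and "\<And>i. i < k \<Longrightarrow> expectation (\<lambda>\<omega>. X i \<omega> ^ 4) = 3 * s i ^ 2"
    and "\<And>i. i < k \<Longrightarrow> 0 \<le> s i"
    and "\<And>i. i < k \<Longrightarrow> c i i = 0"
  shows "integrable M (\<lambda>\<omega>. (\<Sum>i<k. \<Sum>j<k. c i j * X i \<omega> * X j \<omega>) ^ 4) \<and>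
    expectation (\<lambda>\<omega>. (\<Sum>i<k. \<Sum>j<k. c i j * X i \<omega> * X j \<omega>) ^ 2)
      = (\<Sum>i<k. \<Sum>j<k. (c i j + c j i) ^ 2 * s i * s j) / 2 \<and>
    expectation (\<lambda>\<omega>. (\<Sum>i<k. \<Sum>j<k. c i j * X i \<omega> * X j \<omega>) ^ 4)
      \<le> 27 * ((\<Sum>i<k. \<Sum>j<k. (c i j + c j i) ^ 2 * s i * s j) / 2) ^ 2"
  using assms
proof (induction k)
  case 0
  then show ?case by simp
next
  case (Suc k)
  define R where "R \<omega> = restrict (\<lambda>i. X i \<omega>) {..<k}" for \<omega>
  define T where "T \<omega> = restrict (\<lambda>i. X i \<omega>) {k}" for \<omega>
  define p where "p z = (\<Sum>i<k. \<Sum>j<k. c i j * z i * z j)" for z :: "nat \<Rightarrow> real"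
  define l where "l z = (\<Sum>i<k. (c i k + c k i) * z i)" for z :: "nat \<Rightarrow> real"
  define q where "q = (\<Sum>i<k. \<Sum>j<k. (c i j + c j i) ^ 2 * s i * s j) / 2"
  define r where "r = (\<Sum>i<k. (c i k + c k i) ^ 2 * s i)"
  have pR: "p (R \<omega>) = (\<Sum>i<k. \<Sum>j<k. c i j * X i \<omega> * X j \<omega>)"
    and lR: "l (R \<omega>) = (\<Sum>i<k. (c i k + c k i) * X i \<omega>)" and xT: "T \<omega> k = X k \<omega>" for \<omega>
    by (simp_all add: p_def l_def R_def T_def)
  have i: "indep_vars (\<lambda>_. borel) X {..<k}"
    using Suc.prems(1) by (rule indep_vars_subset) auto
  then have IH: "integrable M (\<lambda>\<omega>. p (R \<omega>) ^ 4)" "expectation (\<lambda>\<omega>. p (R \<omega>) ^ 2) = q"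
      "expectation (\<lambda>\<omega>. p (R \<omega>) ^ 4) \<le> 27 * q ^ 2"
    unfolding pR q_def using Suc.IH Suc.prems(2-) by simp_all
  have lin: "integrable M (\<lambda>\<omega>. l (R \<omega>) ^ 4)" "expectation (\<lambda>\<omega>. l (R \<omega>) ^ 2) = r"
      "expectation (\<lambda>\<omega>. l (R \<omega>) ^ 4) = 3 * r ^ 2"
    unfolding lR r_def using linear_form_moments[OF i, of s "\<lambda>i. c i k + c k i"] Suc.prems(2-) by simp_all
  have ind: "indep_var (PiM {..<k} (\<lambda>_. borel)) R (PiM {k} (\<lambda>_. borel)) T"
    unfolding R_def T_def using Suc.prems(1) by (rule indep_vars_split_last)
  have m: "p \<in> borel_measurable (PiM {..<k} (\<lambda>_. borel))" unfolding p_def by measurable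
  have ml: "l \<in> borel_measurable (PiM {..<k} (\<lambda>_. borel))" unfolding l_def by measurable
  have mk: "(\<lambda>z. z k) \<in> borel_measurable (PiM {k} (\<lambda>_. borel :: real measure))" by measurable
  have mR: "R \<in> measurable M (PiM {..<k} (\<lambda>_. borel))" using ind by (rule indep_var_rv1)
  note step = indep_step_moments[where p=p and l=l and x="\<lambda>z. z k" and X=R and Y=T, unfolded xT,
      OF ind m ml mk IH(1) lin(1) Suc.prems(2)[OF lessI] Suc.prems(3)[OF lessI] Suc.prems(5)[OF lessI]]
  have sk: "0 \<le> s k" "\<And>i. i < k \<Longrightarrow> 0 \<le> s i" using Suc.prems(7) by simp_all
  have q0: "0 \<le> q" and r0: "0 \<le> r" using sk by (auto simp: q_def r_def intro!: sum_nonneg mult_nonneg_nonneg)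
  have cs: "expectation (\<lambda>\<omega>. p (R \<omega>) ^ 2 * l (R \<omega>) ^ 2) \<le> (sqrt 27 * q) * (sqrt 3 * r)"
  proof (rule expectation_square_mult_le)
    show "(\<lambda>\<omega>. p (R \<omega>)) \<in> borel_measurable M" "(\<lambda>\<omega>. l (R \<omega>)) \<in> borel_measurable M"
      using measurable_compose[OF mR m] measurable_compose[OF mR ml] .
  qed (use IH lin q0 r0 in \<open>simp_all add: power_mult_distrib\<close>)
  \<comment> \<open>The constants \<open>27\<close> and \<open>3\<close> of the two forms multiply to the square of \<open>9\<close>.\<close>
  have "sqrt 27 * sqrt 3 = (9::real)" by (simp flip: real_sqrt_mult)
  then have cs: "expectation (\<lambda>\<omega>. p (R \<omega>) ^ 2 * l (R \<omega>) ^ 2) \<le> 9 * (q * r)"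
    using cs by (metis mult.assoc mult.left_commute)
  have "c k k = 0" using Suc.prems(8) by simp
  have eq: "(\<Sum>i<Suc k. \<Sum>j<Suc k. c i j * X i \<omega> * X j \<omega>) = p (R \<omega>) + X k \<omega> * l (R \<omega>)" for \<omega>
    using \<open>c k k = 0\<close> by (simp add: pR lR sum.distrib sum_distrib_left algebra_simps)
  have eqv: "(\<Sum>i<Suc k. \<Sum>j<Suc k. (c i j + c j i) ^ 2 * s i * s j) / 2 = q + s k * r"
    using \<open>c k k = 0\<close>
    by (simp add: q_def r_def sum.distrib sum_distrib_left algebra_simps add_divide_distrib)
  have 2: "expectation (\<lambda>\<omega>. X k \<omega> ^ 2) = s k" "expectation (\<lambda>\<omega>. X k \<omega> ^ 4) = 3 * s k ^ 2"
    using Suc.prems(4,6) by simp_all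
  have "expectation (\<lambda>\<omega>. p (R \<omega>) ^ 4) + 6 * s k * expectation (\<lambda>\<omega>. p (R \<omega>) ^ 2 * l (R \<omega>) ^ 2) + 3 * s k ^ 2 * (3 * r ^ 2)
     \<le> 27 * q ^ 2 + 6 * s k * (9 * (q * r)) + 3 * s k ^ 2 * (3 * r ^ 2)"
    using sk cs IH(3) by (intro add_mono mult_left_mono) auto
  also have "\<dots> \<le> 27 * (q + s k * r) ^ 2"
    using zero_le_power2[of "s k * r"] by (simp add: power2_eq_square algebra_simps)
  finally show ?case
    unfolding eq eqv step(2,3) 2 IH lin using step(1) by simp
qed

context brownian_random_measure
begin

lemma moments_B:
  assumes S: "S \<in> sets borel" "emeasure lborel S < \<infinity>"
  shows "integrable M (\<lambda>\<omega>. B S \<omega> ^ 4)" "expectation (B S) = 0"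
    "expectation (\<lambda>\<omega>. B S \<omega> ^ 2) = measure lborel S"
    "expectation (\<lambda>\<omega>. B S \<omega> ^ 3) = 0"
    "expectation (\<lambda>\<omega>. B S \<omega> ^ 4) = 3 * measure lborel S ^ 2"
proof -
  have [measurable]: "B S \<in> borel_measurable M" using random_variable_B[OF S] .
  have "integrable M (\<lambda>\<omega>. B S \<omega> ^ 4) \<and> expectation (B S) = 0 \<and>
    expectation (\<lambda>\<omega>. B S \<omega> ^ 2) = measure lborel S \<and>
    expectation (\<lambda>\<omega>. B S \<omega> ^ 3) = 0 \<and>
    expectation (\<lambda>\<omega>. B S \<omega> ^ 4) = 3 * measure lborel S ^ 2"
  proof (cases "measure lborel S > 0")
    case True
    then have \<sigma>: "0 < sqrt (measure lborel S)" by simp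
    note d = distributed_B[OF S True]
    have e: "expectation (\<lambda>\<omega>. B S \<omega> ^ n) =
        (\<integral>x. normal_density 0 (sqrt (measure lborel S)) x * (x - 0) ^ n \<partial>lborel)" for n
      using distributed_integral[OF d, of "\<lambda>x. x ^ n"] by simp
    have "integrable M (\<lambda>\<omega>. B S \<omega> ^ 4)"
      using distributed_integrable[OF d, of "\<lambda>x. x ^ 4"] integrable_normal_moment[OF \<sigma>, of 0 4] by simp
    moreover have "expectation (\<lambda>\<omega>. B S \<omega> ^ (2 * 1)) = measure lborel S"
      unfolding e integral_normal_moment_even[OF \<sigma>] using \<sigma> by simp
    moreover have "expectation (\<lambda>\<omega>. B S \<omega> ^ (2 * 2)) = 3 * measure lborel S ^ 2"
      unfolding e integral_normal_moment_even[OF \<sigma>] using \<sigma> by (simp add: fact_numeral field_simps)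
    moreover have "expectation (\<lambda>\<omega>. B S \<omega> ^ (2 * 0 + 1)) = 0" "expectation (\<lambda>\<omega>. B S \<omega> ^ (2 * 1 + 1)) = 0"
      unfolding e integral_normal_moment_odd[OF \<sigma>] by simp_all
    ultimately show ?thesis by simp
  next
    case False
    then have 0: "measure lborel S = 0" by (simp add: zero_less_measure_iff)
    then have "emeasure lborel S = 0" using S by (simp add: emeasure_eq_ennreal_measure)
    then have ae: "AE \<omega> in M. B S \<omega> = 0" using S by (intro null_B)
    have n: "integrable M (\<lambda>\<omega>. B S \<omega> ^ n) \<and> expectation (\<lambda>\<omega>. B S \<omega> ^ n) = 0" if "0 < n" for n
    proof -
      have "AE \<omega> in M. B S \<omega> ^ n = 0" using ae by eventually_elim (use that in simp)
      then show ?thesis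
        using integrable_cong_AE[of "\<lambda>\<omega>. B S \<omega> ^ n" M "\<lambda>_. 0"] integral_cong_AE[of "\<lambda>\<omega>. B S \<omega> ^ n" M "\<lambda>_. 0"]
        by simp
    qed
    from n[of 1] n[of 2] n[of 3] n[of 4] show ?thesis by (simp add: 0)
  qed
  then show "integrable M (\<lambda>\<omega>. B S \<omega> ^ 4)" "expectation (B S) = 0"
    "expectation (\<lambda>\<omega>. B S \<omega> ^ 2) = measure lborel S"
    "expectation (\<lambda>\<omega>. B S \<omega> ^ 3) = 0"
    "expectation (\<lambda>\<omega>. B S \<omega> ^ 4) = 3 * measure lborel S ^ 2" by simp_all
qed

lemma step_integral_moments:
  assumes "off_diagonal_step k S c"
  defines "v \<equiv> (\<Sum>i<k. \<Sum>j<k. (c i j + c j i) ^ 2 * measure lborel (S i) * measure lborel (S j)) / 2"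
  shows "integrable M (\<lambda>\<omega>. step_integral B k S c \<omega> ^ 4)"
    "expectation (\<lambda>\<omega>. step_integral B k S c \<omega> ^ 2) = v"
    "expectation (\<lambda>\<omega>. step_integral B k S c \<omega> ^ 4) \<le> 27 * v ^ 2"
proof -
  have S: "S i \<in> sets borel" "emeasure lborel (S i) < \<infinity>" "c i i = 0" if "i < k" for i
    using assms that by (auto simp: off_diagonal_step_def)
  have "indep_vars (\<lambda>_. borel) (\<lambda>i. B (S i)) {..<k}"
    using assms by (intro indep_B) (auto simp: off_diagonal_step_def)
  from quadratic_form_moments[OF this, of "\<lambda>i. measure lborel (S i)" c] S moments_B
  show "integrable M (\<lambda>\<omega>. step_integral B k S c \<omega> ^ 4)"
    "expectation (\<lambda>\<omega>. step_integral B k S c \<omega> ^ 2) = v"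
    "expectation (\<lambda>\<omega>. step_integral B k S c \<omega> ^ 4) \<le> 27 * v ^ 2"
    by (simp_all add: step_integral_def v_def)
qed

end

section \<open>Linearity of the double Wiener integral\<close>

lemma tendsto_0_mono_ennreal:
  fixes f g :: "nat \<Rightarrow> ennreal"
  assumes "\<And>n. f n \<le> g n" "g \<longlonglongrightarrow> 0"
  shows "f \<longlonglongrightarrow> 0"
proof (rule tendsto_sandwich[of "\<lambda>_. 0" f sequentially g 0])
  show "\<forall>\<^sub>F n in sequentially. f n \<le> g n" using assms(1) by simp
qed (use assms(2) in simp_all)

lemma tendsto_L2_lincomb:
  assumes f: "tendsto_L2 N f g" and f': "tendsto_L2 N f' g'"
  shows "tendsto_L2 N (\<lambda>n x. a * f n x + b * f' n x) (\<lambda>x. a * g x + b * g' x)"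
proof -
  have [measurable]: "\<And>n. f n \<in> borel_measurable N" "g \<in> borel_measurable N"
    "\<And>n. f' n \<in> borel_measurable N" "g' \<in> borel_measurable N"
    using f f' by (auto simp: tendsto_L2_def)
  let ?d = "\<lambda>n. \<integral>\<^sup>+x. ennreal ((f n x - g x)\<^sup>2) \<partial>N" and ?d' = "\<lambda>n. \<integral>\<^sup>+x. ennreal ((f' n x - g' x)\<^sup>2) \<partial>N"
  have le: "(\<integral>\<^sup>+x. ennreal ((a * f n x + b * f' n x - (a * g x + b * g' x))\<^sup>2) \<partial>N)
      \<le> ennreal (2 * a\<^sup>2) * ?d n + ennreal (2 * b\<^sup>2) * ?d' n" for n
  proof -
    have "(a * f n x + b * f' n x - (a * g x + b * g' x))\<^sup>2
        \<le> 2 * a\<^sup>2 * (f n x - g x)\<^sup>2 + 2 * b\<^sup>2 * (f' n x - g' x)\<^sup>2" for x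
      using sum_squares_bound[of "a * (f n x - g x)" "b * (f' n x - g' x)"]
      by (simp add: power2_eq_square algebra_simps)
    then have "(\<integral>\<^sup>+x. ennreal ((a * f n x + b * f' n x - (a * g x + b * g' x))\<^sup>2) \<partial>N)
       \<le> (\<integral>\<^sup>+x. ennreal (2 * a\<^sup>2) * ennreal ((f n x - g x)\<^sup>2) + ennreal (2 * b\<^sup>2) * ennreal ((f' n x - g' x)\<^sup>2) \<partial>N)"
      by (intro nn_integral_mono) (simp add: ennreal_leI flip: ennreal_mult ennreal_plus)
    also have "\<dots> = ennreal (2 * a\<^sup>2) * ?d n + ennreal (2 * b\<^sup>2) * ?d' n"
      by (simp add: nn_integral_add nn_integral_cmult)
    finally show ?thesis .
  qed
  have "(\<lambda>n. ennreal (2 * a\<^sup>2) * ?d n + ennreal (2 * b\<^sup>2) * ?d' n) \<longlonglongrightarrow> ennreal (2 * a\<^sup>2) * 0 + ennreal (2 * b\<^sup>2) * 0"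
    using f f' by (intro tendsto_add ennreal_tendsto_cmult) (auto simp: tendsto_L2_def)
  then have "(\<lambda>n. \<integral>\<^sup>+x. ennreal ((a * f n x + b * f' n x - (a * g x + b * g' x))\<^sup>2) \<partial>N) \<longlonglongrightarrow> 0"
    by (intro tendsto_0_mono_ennreal[OF le]) (simp only: mult_zero_right add_0_right)
  then show ?thesis by (simp add: tendsto_L2_def)
qed

lemma tendsto_L2_cong_AE:
  assumes "tendsto_L2 N f g" "\<And>n. f' n \<in> borel_measurable N" "\<And>n. AE x in N. f' n x = f n x"
  shows "tendsto_L2 N f' g"
proof -
  have "(\<integral>\<^sup>+x. ennreal ((f' n x - g x)\<^sup>2) \<partial>N) = (\<integral>\<^sup>+x. ennreal ((f n x - g x)\<^sup>2) \<partial>N)" for n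
    using assms(3)[of n] by (intro nn_integral_cong_AE) (auto elim: eventually_mono)
  then show ?thesis using assms by (simp add: tendsto_L2_def)
qed

lemma tendsto_L2_imp_tendsto_in_prob:
  assumes "tendsto_L2 N f g" "finite_measure N"
  shows "tendsto_in_prob N f g"
  unfolding tendsto_in_prob_def
proof safe
  have [measurable]: "\<And>n. f n \<in> borel_measurable N" "g \<in> borel_measurable N"
    using assms by (auto simp: tendsto_L2_def)
  show "f n \<in> borel_measurable N" "g \<in> borel_measurable N" for n by measurable
  fix \<epsilon> :: real assume \<epsilon>: "0 < \<epsilon>"
  interpret finite_measure N by fact
  have le: "ennreal (measure N {x \<in> space N. \<bar>f n x - g x\<bar> > \<epsilon>})
      \<le> ennreal (1 / \<epsilon>\<^sup>2) * (\<integral>\<^sup>+x. ennreal ((f n x - g x)\<^sup>2) \<partial>N)" for n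
  proof -
    have "{x \<in> space N. \<bar>f n x - g x\<bar> > \<epsilon>} \<subseteq> {x \<in> space N. 1 \<le> ennreal (1 / \<epsilon>\<^sup>2) * ennreal ((f n x - g x)\<^sup>2)}"
    proof safe
      fix x assume "\<epsilon> < \<bar>f n x - g x\<bar>"
      then have "\<epsilon>\<^sup>2 \<le> (f n x - g x)\<^sup>2" using \<epsilon> by (simp add: abs_le_square_iff[symmetric])
      then have "1 \<le> 1 / \<epsilon>\<^sup>2 * (f n x - g x)\<^sup>2" using \<epsilon> by (simp add: field_simps)
      then show "1 \<le> ennreal (1 / \<epsilon>\<^sup>2) * ennreal ((f n x - g x)\<^sup>2)"
        by (simp flip: ennreal_mult)
    qed
    then have "emeasure N {x \<in> space N. \<bar>f n x - g x\<bar> > \<epsilon>}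
        \<le> emeasure N {x \<in> space N. 1 \<le> ennreal (1 / \<epsilon>\<^sup>2) * ennreal ((f n x - g x)\<^sup>2)}"
      by (intro emeasure_mono) auto
    also have "\<dots> \<le> ennreal (1 / \<epsilon>\<^sup>2) * (\<integral>\<^sup>+x. ennreal ((f n x - g x)\<^sup>2) * indicator (space N) x \<partial>N)"
      by (rule nn_integral_Markov_inequality) measurable
    also have "(\<integral>\<^sup>+x. ennreal ((f n x - g x)\<^sup>2) * indicator (space N) x \<partial>N) = (\<integral>\<^sup>+x. ennreal ((f n x - g x)\<^sup>2) \<partial>N)"
      by (intro nn_integral_cong) simp
    finally show ?thesis by (simp add: emeasure_eq_measure)
  qed
  have "(\<lambda>n. ennreal (1 / \<epsilon>\<^sup>2) * (\<integral>\<^sup>+x. ennreal ((f n x - g x)\<^sup>2) \<partial>N)) \<longlonglongrightarrow> ennreal (1 / \<epsilon>\<^sup>2) * 0"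
    using assms by (intro ennreal_tendsto_cmult) (auto simp: tendsto_L2_def)
  then have "(\<lambda>n. ennreal (measure N {x \<in> space N. \<bar>f n x - g x\<bar> > \<epsilon>})) \<longlonglongrightarrow> 0"
    by (intro tendsto_0_mono_ennreal[OF le]) (simp only: mult_zero_right)
  then show "(\<lambda>n. measure N {x \<in> space N. \<bar>f n x - g x\<bar> > \<epsilon>}) \<longlonglongrightarrow> 0"
    by (simp add: tendsto_ennreal_iff[where x=0, simplified])
qed

text \<open>
  At most one of the indicators is nonzero at \<open>x\<close>, so that no cross terms occur.
\<close>

lemma disjoint_indicator_sum_square:
  fixes a :: "nat \<Rightarrow> real"
  assumes "disjoint_family_on S {..<k}"
  shows "(\<Sum>i<k. a i * indicator (S i) x)\<^sup>2 = (\<Sum>i<k. (a i)\<^sup>2 * indicator (S i) x)"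
proof (cases "\<exists>m<k. x \<in> S m")
  case True
  then obtain m where m: "m < k" "x \<in> S m" by auto
  have ind: "indicator (S i) x = (if i = m then 1 else 0 :: real)" if "i < k" for i
    using assms m that by (auto simp: disjoint_family_on_def indicator_def)
  have "(\<Sum>i<k. b i * indicator (S i) x) = b m" for b :: "nat \<Rightarrow> real"
  proof -
    have "(\<Sum>i<k. b i * indicator (S i) x) = (\<Sum>i<k. if i = m then b i else 0)"
      by (intro sum.cong) (auto simp: ind)
    then show ?thesis using m by simp
  qed
  then show ?thesis by simp
next
  case False
  then have "(\<Sum>i<k. b i * indicator (S i) x) = 0" for b :: "nat \<Rightarrow> real"
    by (intro sum.neutral) (auto simp: indicator_def)
  then show ?thesis by simp
qed

lemma step_function_measurable [measurable]:
  assumes "off_diagonal_step k S c"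
  shows "step_function k S c \<in> borel_measurable borel"
proof -
  have S: "S i \<in> sets borel" if "i < k" for i using assms that by (auto simp: off_diagonal_step_def)
  have "(\<lambda>z. \<Sum>i<k. \<Sum>j<k. c i j * indicator (S i) (fst z) * indicator (S j) (snd z) :: real) \<in> borel_measurable (borel \<Otimes>\<^sub>M borel)"
    by (intro borel_measurable_sum borel_measurable_times borel_measurable_const
         measurable_compose[OF measurable_fst] measurable_compose[OF measurable_snd] borel_measurable_indicator) (use S in auto)
  then show ?thesis by (simp add: step_function_def case_prod_unfold borel_prod)
qed

text \<open>
  Twice the quantity \<open>v\<close> of \<open>step_integral_moments\<close>: the second moment of a step integral is one half of
  the squared norm of the symmetrised step function.
\<close>

lemma nn_integral_step_function_symmetrised:
  assumes "off_diagonal_step k S c"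
  shows "(\<integral>\<^sup>+z. ennreal ((step_function k S c z + step_function k S c (prod.swap z))\<^sup>2) \<partial>lborel)
    = ennreal (\<Sum>i<k. \<Sum>j<k. (c i j + c j i)\<^sup>2 * measure lborel (S i) * measure lborel (S j))"
proof -
  have S: "S i \<in> sets borel" "emeasure lborel (S i) < \<infinity>" if "i < k" for i
    using assms that by (auto simp: off_diagonal_step_def)
  have d: "disjoint_family_on S {..<k}"
    using assms by (auto simp: off_diagonal_step_def)
  have sq: "(step_function k S c (x, y) + step_function k S c (y, x))\<^sup>2
      = (\<Sum>i<k. \<Sum>j<k. (c i j + c j i)\<^sup>2 * indicator (S i) x * indicator (S j) y)" for x y
  proof -
    have "step_function k S c (y, x) = (\<Sum>i<k. \<Sum>j<k. c j i * indicator (S i) x * indicator (S j) y)"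
      unfolding step_function_def prod.case by (subst sum.swap) (simp only: mult_ac)
    then have eq: "step_function k S c (x, y) + step_function k S c (y, x)
        = (\<Sum>i<k. (\<Sum>j<k. (c i j + c j i) * indicator (S j) y) * indicator (S i) x)"
      by (simp only: step_function_def prod.case sum_distrib_right sum.distrib distrib_right) (simp only: mult_ac)
    show ?thesis
      unfolding eq disjoint_indicator_sum_square[OF d] by (simp only: sum_distrib_right) (simp only: mult_ac)
  qed
  have "(\<integral>\<^sup>+z. ennreal ((step_function k S c z + step_function k S c (prod.swap z))\<^sup>2) \<partial>lborel)
     = (\<integral>\<^sup>+z. (\<Sum>i<k. \<Sum>j<k. ennreal ((c i j + c j i)\<^sup>2) * (indicator (S i) (fst z) * indicator (S j) (snd z))) \<partial>(lborel \<Otimes>\<^sub>M lborel))"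
    unfolding lborel_prod[symmetric]
  proof (intro nn_integral_cong)
    fix z :: "real \<times> real"
    obtain x y where z: "z = (x, y)" by (cases z)
    have "ennreal ((step_function k S c (x, y) + step_function k S c (y, x))\<^sup>2)
        = (\<Sum>i<k. \<Sum>j<k. ennreal ((c i j + c j i)\<^sup>2 * indicator (S i) x * indicator (S j) y))"
      unfolding sq by (subst sum_ennreal[symmetric], force intro: sum_nonneg,
          intro sum.cong refl sum_ennreal[symmetric], simp)
    also have "\<dots> = (\<Sum>i<k. \<Sum>j<k. ennreal ((c i j + c j i)\<^sup>2) * (indicator (S i) x * indicator (S j) y))"
      by (intro sum.cong refl) (auto split: split_indicator)
    finally show "ennreal ((step_function k S c z + step_function k S c (prod.swap z))\<^sup>2)
      = (\<Sum>i<k. \<Sum>j<k. ennreal ((c i j + c j i)\<^sup>2) * (indicator (S i) (fst z) * indicator (S j) (snd z)))"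
      by (simp only: z prod.swap_def fst_conv snd_conv swap_simp)
  qed
  also have "\<dots> = (\<Sum>i<k. \<Sum>j<k. ennreal ((c i j + c j i)\<^sup>2) * (\<integral>\<^sup>+z. indicator (S i) (fst z) * indicator (S j) (snd z) \<partial>(lborel \<Otimes>\<^sub>M lborel)))"
  proof -
    have m: "(\<lambda>z. ennreal ((c i j + c j i)\<^sup>2) * (indicator (S i) (fst z) * indicator (S j) (snd z)))
        \<in> borel_measurable (lborel \<Otimes>\<^sub>M lborel)"
      "(\<lambda>z. indicator (S i) (fst z) * indicator (S j) (snd z) :: ennreal) \<in> borel_measurable (lborel \<Otimes>\<^sub>M lborel)"
      if "i < k" "j < k" for i j
      using S(1)[OF that(1)] S(1)[OF that(2)] by measurable
    let ?I = "\<lambda>i j z. indicator (S i) (fst z) * indicator (S j) (snd z) :: ennreal"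
    have "(\<integral>\<^sup>+z. (\<Sum>i<k. \<Sum>j<k. ennreal ((c i j + c j i)\<^sup>2) * ?I i j z) \<partial>(lborel \<Otimes>\<^sub>M lborel))
        = (\<Sum>i<k. \<integral>\<^sup>+z. (\<Sum>j<k. ennreal ((c i j + c j i)\<^sup>2) * ?I i j z) \<partial>(lborel \<Otimes>\<^sub>M lborel))"
      by (rule nn_integral_sum) (intro borel_measurable_sum m(1); simp)
    also have "\<dots> = (\<Sum>i<k. \<Sum>j<k. \<integral>\<^sup>+z. ennreal ((c i j + c j i)\<^sup>2) * ?I i j z \<partial>(lborel \<Otimes>\<^sub>M lborel))"
      by (intro sum.cong refl nn_integral_sum m(1)) simp_all
    also have "\<dots> = (\<Sum>i<k. \<Sum>j<k. ennreal ((c i j + c j i)\<^sup>2) * (\<integral>\<^sup>+z. ?I i j z \<partial>(lborel \<Otimes>\<^sub>M lborel)))"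
      by (intro sum.cong refl nn_integral_cmult m(2)) simp_all
    finally show ?thesis .
  qed
  also have "\<dots> = (\<Sum>i<k. \<Sum>j<k. ennreal ((c i j + c j i)\<^sup>2 * measure lborel (S i) * measure lborel (S j)))"
  proof (intro sum.cong refl)
    fix i j assume ij: "i \<in> {..<k}" "j \<in> {..<k}"
    then have [measurable]: "S i \<in> sets borel" "S j \<in> sets borel" using S by auto
    have "(\<integral>\<^sup>+z. indicator (S i) (fst z) * indicator (S j) (snd z) \<partial>(lborel \<Otimes>\<^sub>M lborel))
        = (\<integral>\<^sup>+x. \<integral>\<^sup>+y. indicator (S i) x * indicator (S j) y \<partial>lborel \<partial>lborel)"
      by (subst lborel.nn_integral_fst[symmetric]) auto
    also have "\<dots> = emeasure lborel (S i) * emeasure lborel (S j)"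
      by (simp add: nn_integral_cmult nn_integral_multc)
    also have "\<dots> = ennreal (measure lborel (S i)) * ennreal (measure lborel (S j))"
      using S[of i] S[of j] ij by (simp add: emeasure_eq_ennreal_measure top.not_eq_extremum)
    finally show "ennreal ((c i j + c j i)\<^sup>2) * (\<integral>\<^sup>+z. indicator (S i) (fst z) * indicator (S j) (snd z) \<partial>(lborel \<Otimes>\<^sub>M lborel))
        = ennreal ((c i j + c j i)\<^sup>2 * measure lborel (S i) * measure lborel (S j))"
      by (simp add: ennreal_mult mult.assoc)
  qed
  also have "\<dots> = ennreal (\<Sum>i<k. \<Sum>j<k. (c i j + c j i)\<^sup>2 * measure lborel (S i) * measure lborel (S j))"
    by (simp add: sum_nonneg)
  finally show ?thesis .
qed

lemma sum_marginal:
  fixes \<phi> :: "nat \<times> nat \<Rightarrow> real"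
  assumes I: "I = {..k} \<times> {..l} - {(k, l)}"
    and F: "\<And>i. i < k \<Longrightarrow> (\<Sum>j\<le>l. \<phi> (i, j)) = F i"
    and G: "\<And>j. j < l \<Longrightarrow> (\<Sum>i\<le>k. \<phi> (i, j)) = G j"
  shows "(\<Sum>u\<in>I. (if fst u < k then f (fst u) else 0) * \<phi> u) = (\<Sum>i<k. f i * F i)"
    and "(\<Sum>u\<in>I. (if snd u < l then f (snd u) else 0) * \<phi> u) = (\<Sum>j<l. f j * G j)"
proof -
  have "(\<Sum>u\<in>I. (if fst u < k then f (fst u) else 0) * \<phi> u)
      = (\<Sum>u\<in>{..<k} \<times> {..l}. (if fst u < k then f (fst u) else 0) * \<phi> u)"
    unfolding I by (intro sum.mono_neutral_right) auto
  also have "\<dots> = (\<Sum>i<k. \<Sum>j\<le>l. f i * \<phi> (i, j))"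
    unfolding sum.cartesian_product by (intro sum.cong) auto
  also have "\<dots> = (\<Sum>i<k. f i * F i)" by (simp add: F flip: sum_distrib_left)
  finally show "(\<Sum>u\<in>I. (if fst u < k then f (fst u) else 0) * \<phi> u) = (\<Sum>i<k. f i * F i)" .
  have "(\<Sum>u\<in>I. (if snd u < l then f (snd u) else 0) * \<phi> u)
      = (\<Sum>u\<in>{..k} \<times> {..<l}. (if snd u < l then f (snd u) else 0) * \<phi> u)"
    unfolding I by (intro sum.mono_neutral_right) auto
  also have "\<dots> = (\<Sum>i\<le>k. \<Sum>j<l. f j * \<phi> (i, j))"
    unfolding sum.cartesian_product by (intro sum.cong) auto
  also have "\<dots> = (\<Sum>j<l. f j * G j)" by (subst sum.swap) (simp add: G flip: sum_distrib_left)
  finally show "(\<Sum>u\<in>I. (if snd u < l then f (snd u) else 0) * \<phi> u) = (\<Sum>j<l. f j * G j)" .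
qed

text \<open>
  The refinement of two families with \<open>k\<close> and \<open>l\<close> members is indexed by pairs, where the indices \<open>k\<close>
  and \<open>l\<close> stand for the complements of the two unions; the pair of complements is removed. Taking
  \<open>\<phi>\<close> and \<open>\<psi>\<close> to be indicators gives the identity of step functions, and taking both to be values
  of the random measure gives the identity of step integrals.
\<close>

lemma sum_refine:
  fixes \<phi> \<psi> :: "nat \<times> nat \<Rightarrow> real"
  assumes I: "I = {..k} \<times> {..l} - {(k, l)}"
    and F: "\<And>i. i < k \<Longrightarrow> (\<Sum>j\<le>l. \<phi> (i, j)) = F i" "\<And>j. j < l \<Longrightarrow> (\<Sum>i\<le>k. \<phi> (i, j)) = F' j"
    and G: "\<And>i. i < k \<Longrightarrow> (\<Sum>j\<le>l. \<psi> (i, j)) = G i" "\<And>j. j < l \<Longrightarrow> (\<Sum>i\<le>k. \<psi> (i, j)) = G' j"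
    and e: "\<And>u v. e u v = a * (if fst u < k then if fst v < k then c (fst u) (fst v) else 0 else 0)
                        + b * (if snd u < l then if snd v < l then d (snd u) (snd v) else 0 else 0)"
  shows "(\<Sum>u\<in>I. \<Sum>v\<in>I. e u v * \<phi> u * \<psi> v)
    = a * (\<Sum>i<k. \<Sum>j<k. c i j * F i * G j) + b * (\<Sum>i<l. \<Sum>j<l. d i j * F' i * G' j)"
proof -
  have "(\<Sum>u\<in>I. \<Sum>v\<in>I. e u v * \<phi> u * \<psi> v)
    = a * (\<Sum>u\<in>I. (if fst u < k then \<Sum>v\<in>I. (if fst v < k then c (fst u) (fst v) else 0) * \<psi> v else 0) * \<phi> u)
    + b * (\<Sum>u\<in>I. (if snd u < l then \<Sum>v\<in>I. (if snd v < l then d (snd u) (snd v) else 0) * \<psi> v else 0) * \<phi> u)"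
    unfolding sum_distrib_left sum.distrib[symmetric]
  proof (intro sum.cong refl)
    fix u
    show "(\<Sum>v\<in>I. e u v * \<phi> u * \<psi> v) =
      a * ((if fst u < k then \<Sum>v\<in>I. (if fst v < k then c (fst u) (fst v) else 0) * \<psi> v else 0) * \<phi> u) +
      b * ((if snd u < l then \<Sum>v\<in>I. (if snd v < l then d (snd u) (snd v) else 0) * \<psi> v else 0) * \<phi> u)"
      by (cases "fst u < k"; cases "snd u < l")
         (simp_all add: e sum_distrib_left sum_distrib_right algebra_simps flip: sum.distrib)
  qed
  also have "\<dots> = a * (\<Sum>u\<in>I. (if fst u < k then (\<Sum>p<k. c (fst u) p * G p) else 0) * \<phi> u)
      + b * (\<Sum>u\<in>I. (if snd u < l then (\<Sum>q<l. d (snd u) q * G' q) else 0) * \<phi> u)"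
    by (simp only: sum_marginal(1)[OF I G, of "c _"] sum_marginal(2)[OF I G, of "d _"])
  also have "\<dots> = a * (\<Sum>i<k. (\<Sum>p<k. c i p * G p) * F i) + b * (\<Sum>i<l. (\<Sum>q<l. d i q * G' q) * F' i)"
    by (simp only: sum_marginal(1)[OF I F, of "\<lambda>i. \<Sum>p<k. c i p * G p"]
        sum_marginal(2)[OF I F, of "\<lambda>i. \<Sum>q<l. d i q * G' q"])
  finally show ?thesis by (simp add: sum_distrib_right sum_distrib_left mult_ac)
qed

context brownian_random_measure
begin

lemma step_integral_measurable:
  assumes "off_diagonal_step k S c"
  shows "step_integral B k S c \<in> borel_measurable M"
proof -
  have "B (S i) \<in> borel_measurable M" if "i < k" for i
    using assms that by (intro random_variable_B) (auto simp: off_diagonal_step_def)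
  then show ?thesis unfolding step_integral_def
    by (intro borel_measurable_sum borel_measurable_times) auto
qed

text \<open>
  Countable additivity is applied to the family continued by empty sets, whose values vanish almost
  surely because the empty set is a null set.
\<close>

lemma finitely_additive_B:
  fixes S :: "nat \<Rightarrow> real set"
  assumes "\<And>j. j \<le> n \<Longrightarrow> S j \<in> sets borel" "disjoint_family_on S {..n}"
    and "emeasure lborel (\<Union>j\<le>n. S j) < \<infinity>"
  shows "AE \<omega> in M. (\<Sum>j\<le>n. B (S j) \<omega>) = B (\<Union>j\<le>n. S j) \<omega>"
proof -
  define T where "T j = (if j \<le> n then S j else {})" for j
  have U: "(\<Union>j. T j) = (\<Union>j\<le>n. S j)" by (auto simp: T_def)
  have "AE \<omega> in M. (\<lambda>i. B (T i) \<omega>) sums B (\<Union>i. T i) \<omega>"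
    using assms unfolding U[symmetric]
    by (intro sigma_additive_B) (auto simp: T_def disjoint_family_on_def)
  moreover have "AE \<omega> in M. B {} \<omega> = 0" by (intro null_B) auto
  ultimately show ?thesis
  proof eventually_elim
    case (elim \<omega>)
    have "(\<lambda>i. B (T i) \<omega>) sums (\<Sum>i\<le>n. B (T i) \<omega>)"
      by (rule sums_finite) (use elim in \<open>auto simp: T_def\<close>)
    from sums_unique2[OF this elim(1)] show ?case by (simp add: U) (simp add: T_def)
  qed
qed

text \<open>
  The members of the refinement are the intersections of the cells of the two partitions of the line
  obtained by adding to each family the complement of its union. The intersection of the two
  complements may have infinite measure and is left out; both step functions vanish
  as soon as one coordinate lies in it.
\<close>

lemma common_refinement:
  assumes c: "off_diagonal_step k S c" and d: "off_diagonal_step l T d"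
  shows "\<exists>n U e. off_diagonal_step n U e \<and>
    step_function n U e = (\<lambda>z. a * step_function k S c z + b * step_function l T d z) \<and>
    (AE \<omega> in M. step_integral B n U e \<omega> = a * step_integral B k S c \<omega> + b * step_integral B l T d \<omega>)"
proof -
  define I where "I = {..k} \<times> {..l} - {(k, l)}"
  define S' where "S' i = (if i < k then S i else - (\<Union>i<k. S i))" for i
  define T' where "T' j = (if j < l then T j else - (\<Union>j<l. T j))" for j
  define U where "U u = S' (fst u) \<inter> T' (snd u)" for u
  define e where "e u v = a * (if fst u < k then if fst v < k then c (fst u) (fst v) else 0 else 0)
                        + b * (if snd u < l then if snd v < l then d (snd u) (snd v) else 0 else 0)" for u v
  have S: "S i \<in> sets borel" "emeasure lborel (S i) < \<infinity>" "c i i = 0" if "i < k" for i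
    using c that by (auto simp: off_diagonal_step_def)
  have dS: "S i \<inter> S j = {}" if "i < k" "j < k" "i \<noteq> j" for i j
    using c that by (auto simp: off_diagonal_step_def disjoint_family_on_def)
  have T: "T i \<in> sets borel" "emeasure lborel (T i) < \<infinity>" "d i i = 0" if "i < l" for i
    using d that by (auto simp: off_diagonal_step_def)
  have dT: "T i \<inter> T j = {}" if "i < l" "j < l" "i \<noteq> j" for i j
    using d that by (auto simp: off_diagonal_step_def disjoint_family_on_def)
  have mS': "S' i \<in> sets borel" and mT': "T' i \<in> sets borel" for i
  proof -
    have "(\<Union>i<k. S i) \<in> sets borel" "(\<Union>j<l. T j) \<in> sets borel"
      using S(1) T(1) by (auto intro!: sets.finite_UN)
    then show "S' i \<in> sets borel" "T' i \<in> sets borel"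
      using S(1)[of i] T(1)[of i] unfolding S'_def T'_def by (simp_all only: borel_comp split: if_split) simp_all
  qed
  have mU: "U u \<in> sets borel" for u using mS' mT' by (simp add: U_def)
  have dS': "S' i \<inter> S' j = {}" if "i \<le> k" "j \<le> k" "i \<noteq> j" for i j
    using that dS[of i j] by (auto simp: S'_def)
  have dT': "T' i \<inter> T' j = {}" if "i \<le> l" "j \<le> l" "i \<noteq> j" for i j
    using that dT[of i j] by (auto simp: T'_def)
  have UT: "(\<Union>j\<le>l. U (i, j)) = S i" if "i < k" for i
    using that by (auto simp: U_def S'_def T'_def)
  have US: "(\<Union>i\<le>k. U (i, j)) = T j" if "j < l" for j
    using that by (auto simp: U_def S'_def T'_def)
  have disj: "U u \<inter> U v = {}" if "u \<in> {..k} \<times> {..l}" "v \<in> {..k} \<times> {..l}" "u \<noteq> v" for u v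
    using that dS'[of "fst u" "fst v"] dT'[of "snd u" "snd v"] by (cases u; cases v) (auto simp: U_def)
  have fin: "emeasure lborel (U u) < \<infinity>" if "u \<in> I" for u
  proof (cases "fst u < k")
    case True
    then have "emeasure lborel (U u) \<le> emeasure lborel (S (fst u))"
      using S by (intro emeasure_mono) (auto simp: U_def S'_def)
    then show ?thesis using S(2)[OF True] by (rule le_less_trans)
  next
    case False
    then have l: "snd u < l" using that by (cases u) (auto simp: I_def)
    then have "emeasure lborel (U u) \<le> emeasure lborel (T (snd u))"
      using T by (intro emeasure_mono) (auto simp: U_def T'_def)
    then show ?thesis using T(2)[OF l] by (rule le_less_trans)
  qed
  have ind: "(\<Sum>j\<in>J. indicator (V j) x) = (indicator (\<Union>j\<in>J. V j) x :: real)"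
    if "finite J" "disjoint_family_on V J" for V :: "nat \<Rightarrow> real set" and J x
    using indicator_UN_disjoint[OF that, of x] by (rule sym)
  have djl: "disjoint_family_on (\<lambda>j. U (i, j)) {..l}" if "i < k" for i
    unfolding disjoint_family_on_def using that by (intro ballI impI disj) auto
  have djk: "disjoint_family_on (\<lambda>i. U (i, j)) {..k}" if "j < l" for j
    unfolding disjoint_family_on_def using that by (intro ballI impI disj) auto
  obtain h where h: "bij_betw h {..<card I} I"
    using ex_bij_betw_nat_finite[of I] by (auto simp: I_def atLeast0LessThan)
  have hI: "h m \<in> I" if "m < card I" for m using bij_betwE[OF h] that by auto
  have re: "(\<Sum>m<card I. \<Sum>n<card I. e (h m) (h n) * \<phi> (h m) * \<psi> (h n)) = (\<Sum>u\<in>I. \<Sum>v\<in>I. e u v * \<phi> u * \<psi> v)"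
    for \<phi> \<psi> :: "nat \<times> nat \<Rightarrow> real"
    unfolding sum.reindex_bij_betw[OF h, of "\<lambda>v. e _ v * \<phi> _ * \<psi> v"]
    by (rule sum.reindex_bij_betw[OF h, of "\<lambda>u. \<Sum>v\<in>I. e u v * \<phi> u * \<psi> v"])
  have "off_diagonal_step (card I) (\<lambda>m. U (h m)) (\<lambda>m n. e (h m) (h n))"
    unfolding off_diagonal_step_def
  proof (intro conjI allI impI)
    show "disjoint_family_on (\<lambda>m. U (h m)) {..<card I}"
      unfolding disjoint_family_on_def
    proof (intro ballI impI)
      fix m n assume "m \<in> {..<card I}" "n \<in> {..<card I}" "m \<noteq> n"
      then have "h m \<noteq> h n" "h m \<in> I" "h n \<in> I"
        using h hI by (auto simp: bij_betw_def inj_on_def)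
      then show "U (h m) \<inter> U (h n) = {}" by (intro disj) (auto simp: I_def)
    qed
    show "e (h m) (h m) = 0" for m using S(3) T(3) by (simp add: e_def)
  qed (use mU fin hI in auto)
  moreover have "step_function (card I) (\<lambda>m. U (h m)) (\<lambda>m n. e (h m) (h n))
      = (\<lambda>z. a * step_function k S c z + b * step_function l T d z)"
  proof
    fix z :: "real \<times> real"
    show "step_function (card I) (\<lambda>m. U (h m)) (\<lambda>m n. e (h m) (h n)) z
        = a * step_function k S c z + b * step_function l T d z"
      unfolding step_function_def case_prod_unfold re
        re[of "\<lambda>u. indicator (U u) (fst z)" "\<lambda>u. indicator (U u) (snd z)"]
      by (rule sum_refine[OF I_def])
        (simp_all only: e_def ind[OF finite_atMost djl] ind[OF finite_atMost djk] UT US)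
  qed
  moreover have "AE \<omega> in M. step_integral B (card I) (\<lambda>m. U (h m)) (\<lambda>m n. e (h m) (h n)) \<omega>
      = a * step_integral B k S c \<omega> + b * step_integral B l T d \<omega>"
  proof -
    have 1: "AE \<omega> in M. (\<Sum>j\<le>l. B (U (i, j)) \<omega>) = B (S i) \<omega>" if "i < k" for i
      using finitely_additive_B[of l "\<lambda>j. U (i, j)"] mU djl[OF that] S[OF that] by (simp add: UT[OF that])
    have 2: "AE \<omega> in M. (\<Sum>i\<le>k. B (U (i, j)) \<omega>) = B (T j) \<omega>" if "j < l" for j
      using finitely_additive_B[of k "\<lambda>i. U (i, j)"] mU djk[OF that] T[OF that] by (simp add: US[OF that])
    have "AE \<omega> in M. \<forall>i\<in>{..<k}. (\<Sum>j\<le>l. B (U (i, j)) \<omega>) = B (S i) \<omega>"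
      using 1 by (intro AE_finite_allI) auto
    moreover have "AE \<omega> in M. \<forall>j\<in>{..<l}. (\<Sum>i\<le>k. B (U (i, j)) \<omega>) = B (T j) \<omega>"
      using 2 by (intro AE_finite_allI) auto
    ultimately show ?thesis
    proof eventually_elim
      case (elim \<omega>)
      show ?case
        unfolding step_integral_def re[of "\<lambda>u. B (U u) \<omega>" "\<lambda>u. B (U u) \<omega>"]
        by (rule sum_refine[OF I_def]) (use elim in \<open>simp_all add: e_def\<close>)
    qed
  qed
  ultimately show ?thesis by blast
qed

lemma has_double_wiener_integral_lincomb:
  assumes "has_double_wiener_integral M B f Y" "has_double_wiener_integral M B g Z"
  shows "has_double_wiener_integral M B (\<lambda>z. a * f z + b * g z) (\<lambda>\<omega>. a * Y \<omega> + b * Z \<omega>)"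
proof -
  obtain k S c where f: "\<And>m. off_diagonal_step (k m) (S m) (c m)"
    "tendsto_L2 lborel (\<lambda>m. step_function (k m) (S m) (c m)) f"
    "tendsto_L2 M (\<lambda>m. step_integral B (k m) (S m) (c m)) Y"
    using assms(1) unfolding has_double_wiener_integral_def by blast
  obtain l T d where g: "\<And>m. off_diagonal_step (l m) (T m) (d m)"
    "tendsto_L2 lborel (\<lambda>m. step_function (l m) (T m) (d m)) g"
    "tendsto_L2 M (\<lambda>m. step_integral B (l m) (T m) (d m)) Z"
    using assms(2) unfolding has_double_wiener_integral_def by blast
  define P where "P m t \<longleftrightarrow> off_diagonal_step (fst t) (fst (snd t)) (snd (snd t)) \<and>
    step_function (fst t) (fst (snd t)) (snd (snd t))
       = (\<lambda>z. a * step_function (k m) (S m) (c m) z + b * step_function (l m) (T m) (d m) z) \<and>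
    (AE \<omega> in M. step_integral B (fst t) (fst (snd t)) (snd (snd t)) \<omega>
       = a * step_integral B (k m) (S m) (c m) \<omega> + b * step_integral B (l m) (T m) (d m) \<omega>)" for m t
  have "\<exists>t. P m t" for m
  proof -
    obtain n U e where "off_diagonal_step n U e"
      "step_function n U e = (\<lambda>z. a * step_function (k m) (S m) (c m) z + b * step_function (l m) (T m) (d m) z)"
      "AE \<omega> in M. step_integral B n U e \<omega>
         = a * step_integral B (k m) (S m) (c m) \<omega> + b * step_integral B (l m) (T m) (d m) \<omega>"
      using common_refinement[OF f(1)[of m] g(1)[of m], of a b] by blast
    then show ?thesis by (intro exI[of _ "(n, U, e)"]) (simp add: P_def)
  qed
  then obtain t where t: "\<And>m. P m (t m)" by metis
  define n U e where "n m = fst (t m)" and "U m = fst (snd (t m))" and "e m = snd (snd (t m))" for m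
  have r: "off_diagonal_step (n m) (U m) (e m)"
    "step_function (n m) (U m) (e m)
       = (\<lambda>z. a * step_function (k m) (S m) (c m) z + b * step_function (l m) (T m) (d m) z)"
    "AE \<omega> in M. step_integral B (n m) (U m) (e m) \<omega>
       = a * step_integral B (k m) (S m) (c m) \<omega> + b * step_integral B (l m) (T m) (d m) \<omega>" for m
    using t[of m] by (simp_all add: P_def n_def U_def e_def)
  have "tendsto_L2 lborel (\<lambda>m. step_function (n m) (U m) (e m)) (\<lambda>z. a * f z + b * g z)"
    unfolding r(2) by (rule tendsto_L2_lincomb[OF f(2) g(2)])
  moreover have "tendsto_L2 M (\<lambda>m. step_integral B (n m) (U m) (e m)) (\<lambda>\<omega>. a * Y \<omega> + b * Z \<omega>)"
    by (rule tendsto_L2_cong_AE[OF tendsto_L2_lincomb[OF f(3) g(3)] step_integral_measurable[OF r(1)] r(3)])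
  ultimately show ?thesis using r(1) unfolding has_double_wiener_integral_def by blast
qed

end

section \<open>Normalised kernels that vanish pointwise admit no limit in probability\<close>

text \<open>
  Where \<open>J\<^sup>2\<close> exceeds half its mean \<open>v\<close>, it is bounded by \<open>K v + J\<^sup>4 / (4 K v)\<close>, by the inequality of
  arithmetic and geometric means. Taking
  expectations in the resulting bound for \<open>J\<^sup>2\<close> yields \<open>v \<le> v/2 + K v P + v/4\<close>.
\<close>

lemma (in prob_space) paley_zygmund_fourth_moment:
  fixes J :: "'a \<Rightarrow> real"
  assumes [measurable]: "J \<in> borel_measurable M" and i4: "integrable M (\<lambda>\<omega>. J \<omega> ^ 4)"
    and v: "expectation (\<lambda>\<omega>. J \<omega> ^ 2) = v" "0 < v"
    and K: "expectation (\<lambda>\<omega>. J \<omega> ^ 4) \<le> K * v ^ 2" "0 < K"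
  shows "1 / (4 * K) \<le> prob {\<omega> \<in> space M. v / 2 < J \<omega> ^ 2}"
proof -
  let ?E = "{\<omega> \<in> space M. v / 2 < J \<omega> ^ 2}"
  have le: "J \<omega> ^ 2 \<le> v / 2 + K * v * indicator ?E \<omega> + J \<omega> ^ 4 / (4 * (K * v))" if "\<omega> \<in> space M" for \<omega>
  proof (cases "v / 2 < J \<omega> ^ 2")
    case True
    have "(J \<omega> ^ 2) * (4 * (K * v)) \<le> 4 * (K * v) ^ 2 + J \<omega> ^ 4"
      using sum_squares_bound[of "2 * (K * v)" "J \<omega> ^ 2"] by (simp add: power2_eq_square power4_eq_xxxx algebra_simps)
    then have "J \<omega> ^ 2 \<le> (4 * (K * v) ^ 2 + J \<omega> ^ 4) / (4 * (K * v))"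
      using v(2) K(2) by (simp add: pos_le_divide_eq)
    also have "\<dots> = K * v + J \<omega> ^ 4 / (4 * (K * v))"
      using v(2) K(2) by (simp add: add_divide_distrib power2_eq_square)
    finally show ?thesis using True that v(2) by simp
  next
    case False
    have "0 \<le> J \<omega> ^ 4 / (4 * (K * v))" using v(2) K(2) by simp
    then show ?thesis using False by simp
  qed
  have "integrable M (\<lambda>\<omega>. J \<omega> ^ 2 * J \<omega> ^ 0)"
    by (rule integrable_power4_imp[OF _ _ i4 i4 _ monomial_le_quartic[of 2 0]]) simp_all
  then have i2: "integrable M (\<lambda>\<omega>. J \<omega> ^ 2)" by simp
  have iE: "integrable M (\<lambda>\<omega>. indicator ?E \<omega> :: real)" by (rule integrable_real_indicator) (auto simp: emeasure_eq_measure)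
  have "v \<le> expectation (\<lambda>\<omega>. v / 2 + K * v * indicator ?E \<omega> + J \<omega> ^ 4 / (4 * (K * v)))"
    unfolding v(1)[symmetric]
    by (rule integral_mono[OF i2]) (use le i4 iE v(1) in \<open>auto intro!: Bochner_Integration.integrable_add integrable_mult_right\<close>)
  also have "\<dots> = v / 2 + K * v * prob ?E + expectation (\<lambda>\<omega>. J \<omega> ^ 4) / (4 * (K * v))"
    using i4 iE by (simp add: prob_space)
  also have "expectation (\<lambda>\<omega>. J \<omega> ^ 4) / (4 * (K * v)) \<le> K * v ^ 2 / (4 * (K * v))"
    using K v(2) by (intro divide_right_mono) auto
  also have "\<dots> = v / 4" using K(2) v(2) by (simp add: power2_eq_square)
  finally have "v * (1 / 4) \<le> v * (K * prob ?E)" by (simp add: algebra_simps)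
  then have "1 / 4 \<le> K * prob ?E" using v(2) by (simp only: mult_le_cancel_left_pos)
  then show ?thesis using K(2) by (simp add: field_simps)
qed

lemma nn_integral_lborel_swap:
  fixes h :: "real \<times> real \<Rightarrow> ennreal"
  assumes [measurable]: "h \<in> borel_measurable borel"
  shows "(\<integral>\<^sup>+z. h (prod.swap z) \<partial>lborel) = (\<integral>\<^sup>+z. h z \<partial>lborel)"
proof -
  have h: "h \<in> borel_measurable (lborel \<Otimes>\<^sub>M lborel)" by (simp add: lborel_prod)
  have "(\<integral>\<^sup>+z. h z \<partial>(lborel \<Otimes>\<^sub>M lborel)) = (\<integral>\<^sup>+z. h z \<partial>(distr (lborel \<Otimes>\<^sub>M lborel) (lborel \<Otimes>\<^sub>M lborel) (\<lambda>(x, y). (y, x))))"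
    by (subst lborel_pair.distr_pair_swap) rule
  also have "\<dots> = (\<integral>\<^sup>+z. h (prod.swap z) \<partial>(lborel \<Otimes>\<^sub>M lborel))"
    by (subst nn_integral_distr) (use h in \<open>auto simp: prod.swap_def case_prod_unfold\<close>)
  finally show ?thesis by (simp add: lborel_prod)
qed

context brownian_random_measure
begin

text \<open>
  The tail bound is proved for a sufficiently good step approximation and transferred to the
  limit by convergence in probability. Symmetry of \<open>f\<close> is
  essential: the integral of an antisymmetric kernel is \<open>0\<close>.
\<close>

lemma double_wiener_integral_tail:
  assumes f: "has_double_wiener_integral M B f Y" and sym: "\<And>z. f (prod.swap z) = f z"
    and u: "0 < u" "ennreal u \<le> (\<integral>\<^sup>+z. ennreal ((f z)\<^sup>2) \<partial>lborel)"
  shows "1 / 216 \<le> prob {\<omega> \<in> space M. sqrt u / 4 < \<bar>Y \<omega>\<bar>}"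
proof -
  obtain k S c where s: "\<And>m. off_diagonal_step (k m) (S m) (c m)"
    and gf: "tendsto_L2 lborel (\<lambda>m. step_function (k m) (S m) (c m)) f"
    and JY: "tendsto_L2 M (\<lambda>m. step_integral B (k m) (S m) (c m)) Y"
    using f unfolding has_double_wiener_integral_def by blast
  define g where "g m = step_function (k m) (S m) (c m)" for m
  define J where "J m = step_integral B (k m) (S m) (c m)" for m
  define v where "v m = (\<Sum>i<k m. \<Sum>j<k m. (c m i j + c m j i) ^ 2 * measure lborel (S m i) * measure lborel (S m j)) / 2" for m
  define \<epsilon> where "\<epsilon> m = (\<integral>\<^sup>+z. ennreal ((g m z - f z)\<^sup>2) \<partial>lborel)" for m
  have [measurable]: "g m \<in> borel_measurable borel" for m
    unfolding g_def by (rule step_function_measurable[OF s])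
  have [measurable]: "f \<in> borel_measurable borel" using gf by (simp add: tendsto_L2_def)
  have [measurable]: "J m \<in> borel_measurable M" for m
    unfolding J_def by (rule step_integral_measurable[OF s])
  have [measurable]: "Y \<in> borel_measurable M" using JY by (simp add: tendsto_L2_def)
  have [measurable]: "(prod.swap :: real \<times> real \<Rightarrow> _) \<in> borel \<rightarrow>\<^sub>M borel"
    unfolding borel_prod[symmetric] prod.swap_def by measurable
  have v0: "0 \<le> v m" for m by (auto simp: v_def intro!: sum_nonneg)
  have gv: "(\<integral>\<^sup>+z. ennreal ((g m z + g m (prod.swap z))\<^sup>2) \<partial>lborel) = ennreal (2 * v m)" for m
    unfolding g_def v_def nn_integral_step_function_symmetrised[OF s] by simp
  \<comment> \<open>Comparison of \<open>2 f\<close> with the symmetrised step function; by symmetry of \<open>f\<close> both error terms are equal.\<close>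
  have key: "ennreal (4 * u) \<le> ennreal (4 * v m) + 8 * \<epsilon> m" for m
  proof -
    have pt: "4 * (f z)\<^sup>2 \<le> 2 * (g m z + g m (prod.swap z))\<^sup>2 + 4 * (g m z - f z)\<^sup>2 + 4 * (g m (prod.swap z) - f (prod.swap z))\<^sup>2" for z
    proof -
      have "4 * x\<^sup>2 \<le> 2 * (p + q)\<^sup>2 + 4 * (p - x)\<^sup>2 + 4 * (q - x)\<^sup>2" for p q x :: real
        using zero_le_power2[of "p + q - x"] zero_le_power2[of "p - q"]
        by (simp add: power2_eq_square algebra_simps)
      then show ?thesis by (simp add: sym)
    qed
    have "ennreal (4 * u) = 4 * ennreal u" using u(1) by (simp add: ennreal_mult)
    also have "\<dots> \<le> 4 * (\<integral>\<^sup>+z. ennreal ((f z)\<^sup>2) \<partial>lborel)" using u(2) by (intro mult_left_mono) auto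
    also have "\<dots> = (\<integral>\<^sup>+z. ennreal (4 * (f z)\<^sup>2) \<partial>lborel)"
      by (simp add: nn_integral_cmult ennreal_mult)
    also have "\<dots> \<le> (\<integral>\<^sup>+z. 2 * ennreal ((g m z + g m (prod.swap z))\<^sup>2) + 4 * ennreal ((g m z - f z)\<^sup>2)
                 + 4 * ennreal ((g m (prod.swap z) - f (prod.swap z))\<^sup>2) \<partial>lborel)"
    proof (rule nn_integral_mono)
      fix z :: "real \<times> real"
      have "ennreal (4 * (f z)\<^sup>2) \<le> ennreal (2 * (g m z + g m (prod.swap z))\<^sup>2 + 4 * (g m z - f z)\<^sup>2 + 4 * (g m (prod.swap z) - f (prod.swap z))\<^sup>2)"
        by (rule ennreal_leI[OF pt])
      then show "ennreal (4 * (f z)\<^sup>2) \<le> 2 * ennreal ((g m z + g m (prod.swap z))\<^sup>2) + 4 * ennreal ((g m z - f z)\<^sup>2)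
                 + 4 * ennreal ((g m (prod.swap z) - f (prod.swap z))\<^sup>2)"
        by (simp add: ennreal_plus ennreal_mult)
    qed
    also have "\<dots> = 2 * (\<integral>\<^sup>+z. ennreal ((g m z + g m (prod.swap z))\<^sup>2) \<partial>lborel) + 4 * (\<integral>\<^sup>+z. ennreal ((g m z - f z)\<^sup>2) \<partial>lborel)
                 + 4 * (\<integral>\<^sup>+z. ennreal ((g m (prod.swap z) - f (prod.swap z))\<^sup>2) \<partial>lborel)"
      by (subst nn_integral_add; (measurable)?)+ (simp add: nn_integral_cmult nn_integral_add)
    also have "\<dots> = 2 * ennreal (2 * v m) + 4 * \<epsilon> m + 4 * \<epsilon> m"
      unfolding gv \<epsilon>_def[symmetric]
      using nn_integral_lborel_swap[of "\<lambda>z. ennreal ((g m z - f z)\<^sup>2)"] by (simp add: \<epsilon>_def)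
    also have "\<dots> = ennreal (4 * v m) + 8 * \<epsilon> m"
    proof -
      have "2 * ennreal (2 * v m) = ennreal (4 * v m)"
        using v0[of m] by (simp flip: ennreal_numeral add: ennreal_mult[symmetric])
      moreover have "4 * \<epsilon> m + 4 * \<epsilon> m = 8 * \<epsilon> m" by (simp flip: distrib_right)
      ultimately show ?thesis by (simp only: add.assoc)
    qed
    finally show ?thesis .
  qed
  have "\<epsilon> \<longlonglongrightarrow> 0" using gf unfolding tendsto_L2_def \<epsilon>_def g_def by blast
  then have "eventually (\<lambda>m. \<epsilon> m < ennreal (u / 4)) sequentially"
    using u(1) by (intro order_tendstoD) auto
  moreover have "tendsto_in_prob M J Y"
    using tendsto_L2_imp_tendsto_in_prob[OF JY] finite_measure_axioms by (simp add: J_def[abs_def])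
  then have "(\<lambda>m. prob {\<omega> \<in> space M. \<bar>J m \<omega> - Y \<omega>\<bar> > sqrt u / 4}) \<longlonglongrightarrow> 0"
    unfolding tendsto_in_prob_def using u(1) by (elim conjE allE[of _ "sqrt u / 4"]) simp_all
  then have "eventually (\<lambda>m. prob {\<omega> \<in> space M. \<bar>J m \<omega> - Y \<omega>\<bar> > sqrt u / 4} < 1 / 216) sequentially"
    by (rule order_tendstoD) simp
  ultimately have "eventually (\<lambda>m. \<epsilon> m < ennreal (u / 4) \<and> prob {\<omega> \<in> space M. \<bar>J m \<omega> - Y \<omega>\<bar> > sqrt u / 4} < 1 / 216) sequentially"
    by (rule eventually_conj)
  then obtain m where m: "\<epsilon> m < ennreal (u / 4)" "prob {\<omega> \<in> space M. \<bar>J m \<omega> - Y \<omega>\<bar> > sqrt u / 4} < 1 / 216"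
    using eventually_happens[of _ sequentially] by auto
  have "ennreal (4 * u) \<le> ennreal (4 * v m) + 8 * ennreal (u / 4)"
    using key[of m] m(1) by (meson add_left_mono less_imp_le mult_left_mono order_trans zero_le)
  also have "\<dots> = ennreal (4 * v m + 2 * u)"
    using u(1) v0[of m] by (simp flip: ennreal_numeral add: ennreal_mult[symmetric])
  finally have "4 * u \<le> 4 * v m + 2 * u"
    by (rule ennreal_le_iff[THEN iffD1, rotated]) (use u(1) v0[of m] in simp)
  then have vu: "u / 2 \<le> v m" by simp
  then have vp: "0 < v m" using u(1) by simp
  note mom = step_integral_moments[OF s[of m], folded J_def v_def]
  have "1 / (4 * 27) \<le> prob {\<omega> \<in> space M. v m / 2 < J m \<omega> ^ 2}"
    by (rule paley_zygmund_fourth_moment[OF _ mom(1,2) vp mom(3)]) simp_all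
  also have "\<dots> \<le> prob ({\<omega> \<in> space M. sqrt u / 4 < \<bar>Y \<omega>\<bar>} \<union> {\<omega> \<in> space M. \<bar>J m \<omega> - Y \<omega>\<bar> > sqrt u / 4})"
  proof (rule finite_measure_mono)
    show "{\<omega> \<in> space M. v m / 2 < J m \<omega> ^ 2} \<subseteq> {\<omega> \<in> space M. sqrt u / 4 < \<bar>Y \<omega>\<bar>} \<union> {\<omega> \<in> space M. \<bar>J m \<omega> - Y \<omega>\<bar> > sqrt u / 4}"
    proof safe
      fix \<omega> assume w: "v m / 2 < J m \<omega> ^ 2" "\<not> sqrt u / 4 < \<bar>J m \<omega> - Y \<omega>\<bar>"
      have "(sqrt u / 2)\<^sup>2 < \<bar>J m \<omega>\<bar>\<^sup>2" using w(1) vu u(1) by (simp add: power_divide)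
      then have "sqrt u / 2 < \<bar>J m \<omega>\<bar>" by (rule power2_less_imp_less) simp
      then show "sqrt u / 4 < \<bar>Y \<omega>\<bar>" using w(2) by linarith
    qed
  qed measurable
  also have "\<dots> \<le> prob {\<omega> \<in> space M. sqrt u / 4 < \<bar>Y \<omega>\<bar>} + prob {\<omega> \<in> space M. \<bar>J m \<omega> - Y \<omega>\<bar> > sqrt u / 4}"
    by (rule measure_Un_le) measurable
  finally show ?thesis using m(2) by simp
qed

text \<open>
  If \<open>N\<close> is fixed, then \<open>F N - F m\<close> tends to \<open>F N\<close> almost everywhere, and by Fatou's lemma its norm can
  not drop much below that of \<open>F N\<close>. Hence \<open>W N - W m\<close> is not small in probability for
  some \<open>m \<ge> N\<close>, and the sequence is not Cauchy in probability.
\<close>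

lemma no_limit_in_prob_of_vanishing_kernels:
  assumes W: "\<And>n. has_double_wiener_integral M B (F n) (W n)"
    and sym: "\<And>n z. F n (prod.swap z) = F n z"
    and u: "0 < u" "\<And>n. ennreal u \<le> (\<integral>\<^sup>+z. ennreal ((F n z)\<^sup>2) \<partial>lborel)"
    and F0: "AE z in lborel. (\<lambda>n. F n z) \<longlonglongrightarrow> 0"
  shows "\<not> tendsto_in_prob M W X"
proof
  assume X: "tendsto_in_prob M W X"
  have [measurable]: "F n \<in> borel_measurable borel" for n
    using W[of n] by (auto simp: has_double_wiener_integral_def tendsto_L2_def)
  have [measurable]: "W n \<in> borel_measurable M" "X \<in> borel_measurable M" for n
    using X by (auto simp: tendsto_in_prob_def)
  \<comment> \<open>Half of the threshold in \<open>double_wiener_integral_tail\<close> for a squared norm of at least \<open>u / 2\<close>.\<close>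
  define \<delta> where "\<delta> = sqrt (u / 2) / 8"
  have \<delta>: "0 < \<delta>" using u(1) by (simp add: \<delta>_def)
  have "(\<lambda>n. prob {\<omega> \<in> space M. \<bar>W n \<omega> - X \<omega>\<bar> > \<delta>}) \<longlonglongrightarrow> 0"
    using X \<delta> by (simp add: tendsto_in_prob_def)
  then have "eventually (\<lambda>n. prob {\<omega> \<in> space M. \<bar>W n \<omega> - X \<omega>\<bar> > \<delta>} < 1 / 432) sequentially"
    by (rule order_tendstoD) simp
  then obtain N where N: "\<And>n. N \<le> n \<Longrightarrow> prob {\<omega> \<in> space M. \<bar>W n \<omega> - X \<omega>\<bar> > \<delta>} < 1 / 432"
    by (auto simp: eventually_sequentially)
  have "\<exists>m\<ge>N. ennreal (u / 2) \<le> (\<integral>\<^sup>+z. ennreal ((1 * F N z + (-1) * F m z)\<^sup>2) \<partial>lborel)"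
  proof (rule ccontr)
    assume "\<not> ?thesis"
    then have less: "(\<integral>\<^sup>+z. ennreal ((F N z - F m z)\<^sup>2) \<partial>lborel) \<le> ennreal (u / 2)" if "N \<le> m" for m
      using that by (simp add: not_le) (meson leD less_imp_le)
    have "ennreal u \<le> (\<integral>\<^sup>+z. ennreal ((F N z)\<^sup>2) \<partial>lborel)" by (rule u(2))
    also have "\<dots> = (\<integral>\<^sup>+z. liminf (\<lambda>m. ennreal ((F N z - F m z)\<^sup>2)) \<partial>lborel)"
    proof (rule nn_integral_cong_AE, use F0 in eventually_elim)
      case (elim z)
      have "(\<lambda>m. ennreal ((F N z - F m z)\<^sup>2)) \<longlonglongrightarrow> ennreal ((F N z - 0)\<^sup>2)"
        by (intro tendsto_ennrealI tendsto_intros elim)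
      then have "liminf (\<lambda>m. ennreal ((F N z - F m z)\<^sup>2)) = ennreal ((F N z - 0)\<^sup>2)"
        by (rule lim_imp_Liminf[OF sequentially_bot])
      then show ?case by simp
    qed
    also have "\<dots> \<le> liminf (\<lambda>m. \<integral>\<^sup>+z. ennreal ((F N z - F m z)\<^sup>2) \<partial>lborel)"
      by (rule nn_integral_liminf) measurable
    also have "\<dots> \<le> liminf (\<lambda>m. ennreal (u / 2))"
      using less by (intro Liminf_mono) (auto simp: eventually_sequentially)
    also have "\<dots> = ennreal (u / 2)" by (simp add: Liminf_const)
    finally show False using u(1) by (simp add: ennreal_le_iff)
  qed
  then obtain m where m: "N \<le> m" "ennreal (u / 2) \<le> (\<integral>\<^sup>+z. ennreal ((1 * F N z + (-1) * F m z)\<^sup>2) \<partial>lborel)"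
    by blast
  have "1 / 216 \<le> prob {\<omega> \<in> space M. sqrt (u / 2) / 4 < \<bar>1 * W N \<omega> + (-1) * W m \<omega>\<bar>}"
    by (rule double_wiener_integral_tail[OF has_double_wiener_integral_lincomb[OF W W] _ _ m(2)])
       (use u(1) sym in simp_all)
  also have "\<dots> \<le> prob ({\<omega> \<in> space M. \<bar>W N \<omega> - X \<omega>\<bar> > \<delta>} \<union> {\<omega> \<in> space M. \<bar>W m \<omega> - X \<omega>\<bar> > \<delta>})"
  proof (rule finite_measure_mono, safe)
    fix \<omega>
    assume "sqrt (u / 2) / 4 < \<bar>1 * W N \<omega> + (-1) * W m \<omega>\<bar>" "\<not> \<delta> < \<bar>W m \<omega> - X \<omega>\<bar>"
    then show "\<delta> < \<bar>W N \<omega> - X \<omega>\<bar>" unfolding \<delta>_def by argo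
  qed measurable
  also have "\<dots> \<le> prob {\<omega> \<in> space M. \<bar>W N \<omega> - X \<omega>\<bar> > \<delta>} + prob {\<omega> \<in> space M. \<bar>W m \<omega> - X \<omega>\<bar> > \<delta>}"
    by (rule measure_Un_le) measurable
  also have "\<dots> < 1 / 432 + 1 / 432" using N[of N] N[OF m(1)] by (intro add_strict_mono) auto
  finally show False by simp
qed

end

section \<open>The square norm of the Rosenblatt kernel\<close>

lemma pos_powr_nonneg [simp]: "0 \<le> pos_powr u \<gamma>"
  by (simp add: pos_powr_def)

lemma pos_powr_measurable [measurable]: "(\<lambda>u. pos_powr u \<gamma>) \<in> borel_measurable borel"
  unfolding pos_powr_def by measurable

lemma pos_powr_mult: "0 < c \<Longrightarrow> pos_powr (c * u) \<gamma> = c powr \<gamma> * pos_powr u \<gamma>"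
  by (simp add: pos_powr_def powr_mult zero_less_mult_iff)

lemma nn_integral_Gamma_scaled:
  assumes "0 < s" "0 < c"
  shows "(\<integral>\<^sup>+t. ennreal (pos_powr t (s - 1) * exp (- (c * t))) \<partial>lborel) = ennreal (Gamma s * c powr (- s))"
proof -
  let ?I = "\<integral>\<^sup>+t. ennreal (pos_powr t (s - 1) * exp (- (c * t))) \<partial>lborel"
  have "ennreal (Gamma s) = (\<integral>\<^sup>+t. ennreal (pos_powr t (s - 1) * exp (- t)) \<partial>lborel)"
    unfolding Gamma_conv_nn_integral_real[OF assms(1)]
    by (intro nn_integral_cong) (auto simp: pos_powr_def exp_minus field_simps split: split_indicator)
  also have "\<dots> = ennreal c * (\<integral>\<^sup>+t. ennreal (pos_powr (c * t) (s - 1) * exp (- (c * t))) \<partial>lborel)"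
    using assms(2) by (subst nn_integral_real_affine[where c=c and t=0]) auto
  also have "\<dots> = ennreal c * (\<integral>\<^sup>+t. ennreal (c powr (s - 1)) * ennreal (pos_powr t (s - 1) * exp (- (c * t))) \<partial>lborel)"
    using assms(2) by (simp add: pos_powr_mult ennreal_mult[symmetric] mult.assoc)
  also have "\<dots> = ennreal c * (ennreal (c powr (s - 1)) * ?I)"
    by (subst nn_integral_cmult) auto
  also have "\<dots> = ennreal (c powr s) * ?I"
    using assms(2) by (simp add: mult.assoc[symmetric] ennreal_mult[symmetric] powr_diff)
  finally have e: "ennreal (Gamma s) = ennreal (c powr s) * ?I" .
  have "?I = ennreal (c powr (- s)) * (ennreal (c powr s) * ?I)"
    using assms(2) by (simp add: mult.assoc[symmetric] ennreal_mult[symmetric] powr_minus)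
  also have "\<dots> = ennreal (Gamma s * c powr (- s))"
    unfolding e[symmetric] using assms Gamma_real_pos[of s] by (simp add: ennreal_mult[symmetric] mult.commute)
  finally show ?thesis .
qed

lemma Beta_real_pos: "0 < p \<Longrightarrow> 0 < q \<Longrightarrow> 0 < Beta p (q :: real)"
  by (simp add: Beta_def Gamma_real_pos)

text \<open>
  The integral is multiplied by \<open>Gamma (p + q)\<close>, which by scaling turns \<open>(1 + y)\<^sup>-\<^sup>p\<^sup>-\<^sup>q\<close> into an
  integral of an exponential over a new variable \<open>t\<close>. After an exchange of the two integrals, both
  are again gamma integrals.
\<close>

lemma nn_integral_Beta_half_line:
  assumes "0 < p" "0 < q"
  shows "(\<integral>\<^sup>+y. ennreal (pos_powr y (p - 1) * pos_powr (1 + y) (- p - q)) \<partial>lborel) = ennreal (Beta p q)"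
proof -
  let ?I = "\<integral>\<^sup>+y. ennreal (pos_powr y (p - 1) * pos_powr (1 + y) (- p - q)) \<partial>lborel"
  have G: "0 < Gamma (p + q)" "0 < Gamma p" "0 < Gamma q" using assms by (simp_all add: Gamma_real_pos)
  have "ennreal (Gamma (p + q)) * ?I
      = (\<integral>\<^sup>+y. ennreal (Gamma (p + q)) * ennreal (pos_powr y (p - 1) * pos_powr (1 + y) (- p - q)) \<partial>lborel)"
    by (subst nn_integral_cmult) auto
  also have "\<dots> = (\<integral>\<^sup>+y. \<integral>\<^sup>+t. ennreal (pos_powr y (p - 1)) * ennreal (pos_powr t (p + q - 1) * exp (- ((1 + y) * t))) \<partial>lborel \<partial>lborel)"
  proof (rule nn_integral_cong)
    fix y :: real
    show "ennreal (Gamma (p + q)) * ennreal (pos_powr y (p - 1) * pos_powr (1 + y) (- p - q))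
       = (\<integral>\<^sup>+t. ennreal (pos_powr y (p - 1)) * ennreal (pos_powr t (p + q - 1) * exp (- ((1 + y) * t))) \<partial>lborel)"
    proof (cases "0 < y")
      case True
      then show ?thesis
        using nn_integral_Gamma_scaled[of "p + q" "1 + y"] assms G
        by (subst nn_integral_cmult) (auto simp: ennreal_mult[symmetric] pos_powr_def)
    qed (simp add: pos_powr_def)
  qed
  also have "\<dots> = (\<integral>\<^sup>+t. \<integral>\<^sup>+y. ennreal (pos_powr y (p - 1)) * ennreal (pos_powr t (p + q - 1) * exp (- ((1 + y) * t))) \<partial>lborel \<partial>lborel)"
    by (rule lborel_pair.Fubini'[symmetric]) measurable
  also have "\<dots> = (\<integral>\<^sup>+t. ennreal (Gamma p) * ennreal (pos_powr t (q - 1) * exp (- (1 * t))) \<partial>lborel)"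
  proof (rule nn_integral_cong)
    fix t :: real
    have "(\<integral>\<^sup>+y. ennreal (pos_powr y (p - 1)) * ennreal (pos_powr t (p + q - 1) * exp (- ((1 + y) * t))) \<partial>lborel)
       = (\<integral>\<^sup>+y. ennreal (pos_powr t (p + q - 1) * exp (- t)) * ennreal (pos_powr y (p - 1) * exp (- (t * y))) \<partial>lborel)"
      by (intro nn_integral_cong) (simp add: ennreal_mult[symmetric] algebra_simps exp_add[symmetric])
    also have "\<dots> = ennreal (pos_powr t (p + q - 1) * exp (- t)) * (\<integral>\<^sup>+y. ennreal (pos_powr y (p - 1) * exp (- (t * y))) \<partial>lborel)"
      by (rule nn_integral_cmult) measurable
    also have "\<dots> = ennreal (Gamma p) * ennreal (pos_powr t (q - 1) * exp (- (1 * t)))"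
    proof (cases "0 < t")
      case True
      have "t powr (p + q - 1) * t powr (- p) = t powr (q - 1)" by (simp flip: powr_add)
      then show ?thesis
        using nn_integral_Gamma_scaled[OF assms(1) True] True G
        by (simp add: pos_powr_def ennreal_mult[symmetric] mult_ac)
    qed (simp add: pos_powr_def)
    finally show "(\<integral>\<^sup>+y. ennreal (pos_powr y (p - 1)) * ennreal (pos_powr t (p + q - 1) * exp (- ((1 + y) * t))) \<partial>lborel)
       = ennreal (Gamma p) * ennreal (pos_powr t (q - 1) * exp (- (1 * t)))" .
  qed
  also have "\<dots> = ennreal (Gamma p) * (\<integral>\<^sup>+t. ennreal (pos_powr t (q - 1) * exp (- (1 * t))) \<partial>lborel)"
    by (rule nn_integral_cmult) measurable
  also have "\<dots> = ennreal (Gamma p * Gamma q)"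
    using G assms by (subst nn_integral_Gamma_scaled) (auto simp: ennreal_mult[symmetric])
  finally have e: "ennreal (Gamma (p + q)) * ?I = ennreal (Gamma p * Gamma q)" .
  have "?I = ennreal (1 / Gamma (p + q)) * (ennreal (Gamma (p + q)) * ?I)"
    using G by (simp add: mult.assoc[symmetric] ennreal_mult[symmetric])
  also have "\<dots> = ennreal (Beta p q)"
    unfolding e using G by (simp add: ennreal_mult[symmetric] Beta_def)
  finally show ?thesis .
qed

text \<open>
  The substitution \<open>x = r - (s - r) y\<close> reduces the integral to the beta integral over a half line.
\<close>

lemma nn_integral_pos_powr_convolution:
  assumes "r < s" "-1 < b" "a + b < -1"
  shows "(\<integral>\<^sup>+x. ennreal (pos_powr (s - x) a * pos_powr (r - x) b) \<partial>lborel)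
    = ennreal ((s - r) powr (a + b + 1) * Beta (b + 1) (- a - b - 1))"
proof -
  define d where "d = s - r"
  have d: "0 < d" using assms by (simp add: d_def)
  have sx: "s - (r + - d * y) = d * (1 + y)" and rx: "r - (r + - d * y) = d * y" for y
    by (simp_all add: d_def algebra_simps)
  have pt: "pos_powr (d * (1 + y)) a * pos_powr (d * y) b = d powr (a + b) * (pos_powr y b * pos_powr (1 + y) a)" for y
    unfolding pos_powr_mult[OF d] by (simp add: powr_add)
  have "(\<integral>\<^sup>+x. ennreal (pos_powr (s - x) a * pos_powr (r - x) b) \<partial>lborel)
      = ennreal \<bar>- d\<bar> * (\<integral>\<^sup>+y. ennreal (pos_powr (s - (r + - d * y)) a * pos_powr (r - (r + - d * y)) b) \<partial>lborel)"
    using d by (intro nn_integral_real_affine) auto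
  also have "\<dots> = ennreal d * (\<integral>\<^sup>+y. ennreal (d powr (a + b)) * ennreal (pos_powr y ((b + 1) - 1) * pos_powr (1 + y) (- (b + 1) - (- a - b - 1))) \<partial>lborel)"
    unfolding sx rx pt using d by (simp add: ennreal_mult[symmetric])
  also have "\<dots> = ennreal d * (ennreal (d powr (a + b)) * ennreal (Beta (b + 1) (- a - b - 1)))"
    using nn_integral_Beta_half_line[of "b + 1" "- a - b - 1"] assms by (subst nn_integral_cmult) auto
  also have "\<dots> = ennreal (d powr (a + b + 1) * Beta (b + 1) (- a - b - 1))"
  proof -
    have "d powr (a + b + 1) = d * d powr (a + b)" using d by (simp add: powr_add)
    then show ?thesis using d by (simp add: ennreal_mult' mult.assoc)
  qed
  finally show ?thesis by (simp add: d_def)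
qed

lemma nn_integral_powr_Icc:
  assumes "-1 < \<rho>" "0 \<le> c"
  shows "(\<integral>\<^sup>+x. ennreal (indicator {0..c} x * pos_powr x \<rho>) \<partial>lborel) = ennreal (c powr (\<rho> + 1) / (\<rho> + 1))"
proof -
  have "(\<integral>\<^sup>+x. ennreal (indicator {0..c} x * x powr \<rho>) \<partial>lborel) = ennreal (c powr (\<rho> + 1) / (\<rho> + 1))"
    by (rule nn_integral_has_integral_lebesgue[OF _ has_integral_powr_from_0[OF assms]]) simp
  moreover have "indicator {0..c} x * x powr \<rho> = indicator {0..c} x * pos_powr x \<rho>" for x
    by (auto simp: pos_powr_def split: split_indicator)
  ultimately show ?thesis by simp
qed

text \<open>
  The two triangles \<open>r < s\<close> and \<open>s < r\<close> contribute equally.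
\<close>

lemma nn_integral_unit_square_powr:
  assumes "-1 < \<rho>"
  shows "(\<integral>\<^sup>+s. \<integral>\<^sup>+r. ennreal (indicator {0..1} s * indicator {0..1} r * \<bar>s - r\<bar> powr \<rho>) \<partial>lborel \<partial>lborel)
    = ennreal (2 / ((\<rho> + 1) * (\<rho> + 2)))"
proof -
  let ?f = "\<lambda>s r :: real. ennreal (indicator {0..1} s * indicator {0..1} r * pos_powr (s - r) \<rho>)"
  have inner: "(\<integral>\<^sup>+r. ?f s r \<partial>lborel) = ennreal (1 / (\<rho> + 1)) * ennreal (indicator {0..1} s * pos_powr s (\<rho> + 1))" for s
  proof -
    have "(\<integral>\<^sup>+r. ?f s r \<partial>lborel) = ennreal \<bar>- 1\<bar> * (\<integral>\<^sup>+y. ?f s (s + - 1 * y) \<partial>lborel)"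
      by (intro nn_integral_real_affine) auto
    also have "\<dots> = (\<integral>\<^sup>+y. ennreal (indicator {0..1} s * (indicator {0..s} y * pos_powr y \<rho>)) \<partial>lborel)"
      by (auto intro!: nn_integral_cong simp: pos_powr_def split: split_indicator)
    also have "\<dots> = ennreal (indicator {0..1} s * (pos_powr s (\<rho> + 1) / (\<rho> + 1)))"
      using nn_integral_powr_Icc[OF assms, of s] assms
      by (cases "s \<in> {0..1}") (auto simp: pos_powr_def powr_def)
    also have "\<dots> = ennreal (1 / (\<rho> + 1)) * ennreal (indicator {0..1} s * pos_powr s (\<rho> + 1))"
      using assms by (simp add: ennreal_mult[symmetric] mult_ac)
    finally show ?thesis .
  qed
  have J: "(\<integral>\<^sup>+s. \<integral>\<^sup>+r. ?f s r \<partial>lborel \<partial>lborel) = ennreal (1 / ((\<rho> + 1) * (\<rho> + 2)))"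
    unfolding inner using nn_integral_powr_Icc[of "\<rho> + 1" 1] assms
    by (subst nn_integral_cmult) (auto simp: ennreal_mult[symmetric] add.assoc)
  have J': "(\<integral>\<^sup>+s. \<integral>\<^sup>+r. ?f r s \<partial>lborel \<partial>lborel) = (\<integral>\<^sup>+s. \<integral>\<^sup>+r. ?f s r \<partial>lborel \<partial>lborel)"
    by (rule lborel_pair.Fubini') measurable
  have "(\<integral>\<^sup>+s. \<integral>\<^sup>+r. ennreal (indicator {0..1} s * indicator {0..1} r * \<bar>s - r\<bar> powr \<rho>) \<partial>lborel \<partial>lborel)
      = (\<integral>\<^sup>+s. \<integral>\<^sup>+r. ?f s r + ?f r s \<partial>lborel \<partial>lborel)"
    by (intro nn_integral_cong) (auto simp: pos_powr_def abs_if split: split_indicator)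
  also have "\<dots> = (\<integral>\<^sup>+s. \<integral>\<^sup>+r. ?f s r \<partial>lborel \<partial>lborel) + (\<integral>\<^sup>+s. \<integral>\<^sup>+r. ?f r s \<partial>lborel \<partial>lborel)"
    by (simp add: nn_integral_add)
  also have "\<dots> = ennreal (2 / ((\<rho> + 1) * (\<rho> + 2)))"
    unfolding J' J using assms by (simp add: ennreal_plus[symmetric] del: ennreal_plus)
  finally show ?thesis .
qed

text \<open>
  The integrand of the Rosenblatt kernel at the fixed time \<open>s\<close>, as a function on the plane.
\<close>

definition "Rosenblatt_slice a b s =
  (\<lambda>(x, y). pos_powr (s - x) a * pos_powr (s - y) b + pos_powr (s - x) b * pos_powr (s - y) a)"

lemma Rosenblatt_slice_nonneg [simp]: "0 \<le> Rosenblatt_slice a b s z"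
  by (simp add: Rosenblatt_slice_def split: prod.split)

lemma Rosenblatt_slice_measurable [measurable]:
  "(\<lambda>(s, z). Rosenblatt_slice a b s z) \<in> borel_measurable (borel \<Otimes>\<^sub>M (borel \<Otimes>\<^sub>M borel))"
  unfolding Rosenblatt_slice_def by measurable

text \<open>
  The kernel at time \<open>1\<close> as an integral with values in \<open>[0, \<infinity>]\<close>. Tonelli's theorem applies to it
  without any integrability hypothesis, and it agrees with the kernel off the diagonal.
\<close>

definition "nn_Rosenblatt_kernel a b z = (\<integral>\<^sup>+s. ennreal (indicator {0..1} s * Rosenblatt_slice a b s z) \<partial>lborel)"

lemma nn_Rosenblatt_kernel_swap:
  "nn_Rosenblatt_kernel a b (prod.swap z) = nn_Rosenblatt_kernel a b z"
  by (cases z) (simp add: nn_Rosenblatt_kernel_def Rosenblatt_slice_def add.commute mult.commute)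

lemma Rosenblatt_kernel_swap:
  "Rosenblatt_kernel a b t (prod.swap z) = Rosenblatt_kernel a b t z"
  by (cases z) (simp add: Rosenblatt_kernel_def add.commute mult.commute)

text \<open>
  Expanding the product of two slices gives four products of a function of \<open>x\<close> and a function of
  \<open>y\<close>, each integral being of the form of \<open>nn_integral_pos_powr_convolution\<close>. The mixed integrals
  depend on the order of \<open>s\<close> and \<open>r\<close>, but they occur in pairs whose product does not.
\<close>

lemma Rosenblatt_slice_covariance:
  assumes "-1 < a" "a < -1/2" "-1 < b" "b < -1/2" "s \<noteq> r"
  shows "(\<integral>\<^sup>+z. ennreal (Rosenblatt_slice a b s z * Rosenblatt_slice a b r z) \<partial>lborel)
    = ennreal (\<bar>s - r\<bar> powr (2 * a + 2 * b + 2) *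
        (2 * (Beta (a + 1) (- a - b - 1) * Beta (b + 1) (- a - b - 1)
           + Beta (a + 1) (- 2 * a - 1) * Beta (b + 1) (- 2 * b - 1))))"
proof -
  define F where "F c d = (\<integral>\<^sup>+x. ennreal (pos_powr (s - x) c * pos_powr (r - x) d) \<partial>lborel)" for c d
  define D where "D = Beta (a + 1) (- a - b - 1) * Beta (b + 1) (- a - b - 1)
           + Beta (a + 1) (- 2 * a - 1) * Beta (b + 1) (- 2 * b - 1)"
  note B = Beta_real_pos[THEN less_imp_le]
  have Fv: "F c d = ennreal (\<bar>s - r\<bar> powr (c + d + 1) * (if r < s then Beta (d + 1) (- c - d - 1) else Beta (c + 1) (- c - d - 1)))"
    if "-1 < c" "-1 < d" "c + d < -1" for c d
  proof (cases "r < s")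
    case True
    then show ?thesis using nn_integral_pos_powr_convolution[OF True that(2,3)] by (simp add: F_def)
  next
    case False
    then have "s < r" using assms by simp
    have e: "- d - c - 1 = - c - d - 1" "d + c = c + d" by simp_all
    from nn_integral_pos_powr_convolution[OF \<open>s < r\<close> that(1), of d] that \<open>s < r\<close> show ?thesis
      unfolding e by (simp add: F_def mult.commute[of "pos_powr (s - _) c"])
  qed
  have sum: "F a a * F b b + F a b * F b a = ennreal (\<bar>s - r\<bar> powr (2 * a + 2 * b + 2) * D)"
  proof -
    have p: "\<bar>s - r\<bar> powr (a + a + 1) * \<bar>s - r\<bar> powr (b + b + 1) = \<bar>s - r\<bar> powr (2 * a + 2 * b + 2)"
      "\<bar>s - r\<bar> powr (a + b + 1) * \<bar>s - r\<bar> powr (b + a + 1) = \<bar>s - r\<bar> powr (2 * a + 2 * b + 2)"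
      by (simp_all flip: powr_add add: algebra_simps)
    have "F a a * F b b = ennreal (\<bar>s - r\<bar> powr (2 * a + 2 * b + 2) * (Beta (a + 1) (- 2 * a - 1) * Beta (b + 1) (- 2 * b - 1)))"
      using assms unfolding p(1)[symmetric] by (simp add: Fv B ennreal_mult[symmetric] mult_ac)
    moreover have "F a b * F b a = ennreal (\<bar>s - r\<bar> powr (2 * a + 2 * b + 2) * (Beta (a + 1) (- a - b - 1) * Beta (b + 1) (- a - b - 1)))"
    proof -
      have "- b - a - 1 = - a - b - 1" by simp
      then show ?thesis
        using assms unfolding p(2)[symmetric]
        by (simp add: Fv B ennreal_mult[symmetric] mult_ac \<open>- b - a - 1 = - a - b - 1\<close>)
    qed
    ultimately show ?thesis
      using assms by (simp add: D_def B distrib_left ennreal_plus[symmetric] add.commute del: ennreal_plus)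
  qed
  have [measurable]: "(\<lambda>x. ennreal (pos_powr (s - x) c * pos_powr (r - x) d)) \<in> borel_measurable borel" for c d
    by measurable
  let ?f = "\<lambda>c d x. ennreal (pos_powr (s - x) c * pos_powr (r - x) d)"
  have "(\<integral>\<^sup>+z. ennreal (Rosenblatt_slice a b s z * Rosenblatt_slice a b r z) \<partial>lborel)
     = (\<integral>\<^sup>+x. \<integral>\<^sup>+y. ennreal (Rosenblatt_slice a b s (x, y) * Rosenblatt_slice a b r (x, y)) \<partial>lborel \<partial>lborel)"
    unfolding lborel_prod[symmetric] by (subst lborel.nn_integral_fst[symmetric]) auto
  also have "\<dots> = (\<integral>\<^sup>+x. \<integral>\<^sup>+y. ?f a a x * ?f b b y + ?f a b x * ?f b a y + ?f b a x * ?f a b y + ?f b b x * ?f a a y \<partial>lborel \<partial>lborel)"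
    by (intro nn_integral_cong)
       (simp add: Rosenblatt_slice_def ennreal_mult[symmetric] ennreal_plus[symmetric] algebra_simps del: ennreal_plus)
  also have "\<dots> = (\<integral>\<^sup>+x. ?f a a x * F b b + ?f a b x * F b a + ?f b a x * F a b + ?f b b x * F a a \<partial>lborel)"
    by (simp add: nn_integral_add nn_integral_cmult F_def)
  also have "\<dots> = F a a * F b b + F a b * F b a + F b a * F a b + F b b * F a a"
    by (simp add: nn_integral_add nn_integral_multc F_def)
  also have "\<dots> = 2 * (F a a * F b b + F a b * F b a)"
    unfolding mult_2 by (simp only: mult_ac add_ac)
  also have "\<dots> = ennreal (\<bar>s - r\<bar> powr (2 * a + 2 * b + 2) * (2 * D))"
  proof -
    have "0 \<le> D" using assms unfolding D_def by (intro add_nonneg_nonneg mult_nonneg_nonneg B) auto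
    then show ?thesis unfolding sum by (simp add: ennreal_mult mult_ac)
  qed
  finally show ?thesis unfolding D_def .
qed

text \<open>
  The square is a double integral over \<open>s\<close> and \<open>r\<close>; with the plane integrated first, the slices
  contribute a power of \<open>\<bar>s - r\<bar>\<close>. Its exponent \<open>2 a + 2 b + 2\<close> exceeds \<open>-1\<close> exactly because
  \<open>a + b > -3/2\<close>.
\<close>

lemma nn_integral_Rosenblatt_kernel_square:
  assumes "-1 < a" "a < -1/2" "-1 < b" "b < -1/2" "a + b > -3/2"
  shows "(\<integral>\<^sup>+z. (nn_Rosenblatt_kernel a b z)\<^sup>2 \<partial>lborel)
    = ennreal (2 * (Beta (a + 1) (- a - b - 1) * Beta (b + 1) (- a - b - 1)
           + Beta (a + 1) (- 2 * a - 1) * Beta (b + 1) (- 2 * b - 1)) / ((a + b + 2) * (2 * (a + b) + 3)))"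
proof -
  define D where "D = Beta (a + 1) (- a - b - 1) * Beta (b + 1) (- a - b - 1)
           + Beta (a + 1) (- 2 * a - 1) * Beta (b + 1) (- 2 * b - 1)"
  note B = Beta_real_pos[THEN less_imp_le]
  have D: "0 \<le> D" using assms unfolding D_def by (intro add_nonneg_nonneg mult_nonneg_nonneg B) auto
  let ?g = "\<lambda>s z. ennreal (indicator {0..1} s * Rosenblatt_slice a b s z)"
  have gm [measurable]: "(\<lambda>(s, z). ?g s z) \<in> borel_measurable (lborel \<Otimes>\<^sub>M lborel)"
    unfolding lborel_prod[symmetric] by (simp add: case_prod_unfold) measurable
  have [measurable]: "(\<lambda>s. ?g s z) \<in> borel_measurable borel" "(\<lambda>z. ?g s z) \<in> borel_measurable borel" for s z
    unfolding Rosenblatt_slice_def borel_prod[symmetric] by measurable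
  have "(nn_Rosenblatt_kernel a b z)\<^sup>2 = (\<integral>\<^sup>+s. \<integral>\<^sup>+r. ?g s z * ?g r z \<partial>lborel \<partial>lborel)" for z
  proof -
    have m: "(\<lambda>s. ?g s z) \<in> borel_measurable lborel" by measurable
    show ?thesis
      unfolding nn_Rosenblatt_kernel_def power2_eq_square nn_integral_cmult[OF m] nn_integral_multc[OF m] ..
  qed
  then have "(\<integral>\<^sup>+z. (nn_Rosenblatt_kernel a b z)\<^sup>2 \<partial>lborel) = (\<integral>\<^sup>+z. \<integral>\<^sup>+s. \<integral>\<^sup>+r. ?g s z * ?g r z \<partial>lborel \<partial>lborel \<partial>lborel)"
    by simp
  also have "\<dots> = (\<integral>\<^sup>+s. \<integral>\<^sup>+z. \<integral>\<^sup>+r. ?g s z * ?g r z \<partial>lborel \<partial>lborel \<partial>lborel)"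
    by (rule lborel_pair.Fubini'[symmetric]) (simp add: case_prod_unfold, measurable)
  also have "\<dots> = (\<integral>\<^sup>+s. \<integral>\<^sup>+r. \<integral>\<^sup>+z. ?g s z * ?g r z \<partial>lborel \<partial>lborel \<partial>lborel)"
    by (intro nn_integral_cong lborel_pair.Fubini'[symmetric]) (simp add: case_prod_unfold, measurable)
  also have "\<dots> = (\<integral>\<^sup>+s. \<integral>\<^sup>+r. ennreal (2 * D) * ennreal (indicator {0..1} s * indicator {0..1} r * \<bar>s - r\<bar> powr (2 * a + 2 * b + 2)) \<partial>lborel \<partial>lborel)"
  proof (rule nn_integral_cong, rule nn_integral_cong_AE)
    fix s :: real
    show "AE r in lborel. (\<integral>\<^sup>+z. ?g s z * ?g r z \<partial>lborel)
        = ennreal (2 * D) * ennreal (indicator {0..1} s * indicator {0..1} r * \<bar>s - r\<bar> powr (2 * a + 2 * b + 2))"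
      using AE_lborel_singleton[of s]
    proof eventually_elim
      case (elim r)
      have "(\<integral>\<^sup>+z. ?g s z * ?g r z \<partial>lborel)
          = (\<integral>\<^sup>+z. ennreal (indicator {0..1} s * indicator {0..1} r) * ennreal (Rosenblatt_slice a b s z * Rosenblatt_slice a b r z) \<partial>lborel)"
        by (intro nn_integral_cong) (auto split: split_indicator simp: ennreal_mult)
      also have "\<dots> = ennreal (indicator {0..1} s * indicator {0..1} r) * (\<integral>\<^sup>+z. ennreal (Rosenblatt_slice a b s z * Rosenblatt_slice a b r z) \<partial>lborel)"
        by (cases "s \<in> {0..1} \<and> r \<in> {0..1}") auto
      also have "\<dots> = ennreal (indicator {0..1} s * indicator {0..1} r) * ennreal (\<bar>s - r\<bar> powr (2 * a + 2 * b + 2) * (2 * D))"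
        using elim assms by (subst Rosenblatt_slice_covariance) (auto simp: D_def)
      finally show ?case using D by (auto split: split_indicator simp: ennreal_mult mult_ac)
    qed
  qed
  also have "\<dots> = (\<integral>\<^sup>+s. ennreal (2 * D) * (\<integral>\<^sup>+r. ennreal (indicator {0..1} s * indicator {0..1} r * \<bar>s - r\<bar> powr (2 * a + 2 * b + 2)) \<partial>lborel) \<partial>lborel)"
    by (intro nn_integral_cong nn_integral_cmult) measurable
  also have "\<dots> = ennreal (2 * D) * (\<integral>\<^sup>+s. \<integral>\<^sup>+r. ennreal (indicator {0..1} s * indicator {0..1} r * \<bar>s - r\<bar> powr (2 * a + 2 * b + 2)) \<partial>lborel \<partial>lborel)"
    by (rule nn_integral_cmult) measurable
  also have "\<dots> = ennreal (2 * D) * ennreal (2 / ((2 * a + 2 * b + 2 + 1) * (2 * a + 2 * b + 2 + 2)))"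
    using nn_integral_unit_square_powr[of "2 * a + 2 * b + 2"] assms by simp
  also have "\<dots> = ennreal (2 * D / ((a + b + 2) * (2 * (a + b) + 3)))"
  proof -
    have "2 / ((2 * a + 2 * b + 2 + 1) * (2 * a + 2 * b + 2 + 2)) = 1 / ((a + b + 2) * (2 * (a + b) + 3))"
    proof -
      have "(2 * a + 2 * b + 2 + 1) * (2 * a + 2 * b + 2 + 2) = 2 * ((a + b + 2) * (2 * (a + b) + 3))"
        by (simp add: algebra_simps)
      then show ?thesis by (simp only:) simp
    qed
    then show ?thesis using D by (simp add: ennreal_mult'[symmetric])
  qed
  finally show ?thesis by (simp add: D_def)
qed

text \<open>
  Let \<open>x < y\<close> be the coordinates. The slice vanishes for \<open>s \<le> y\<close>, and for \<open>s > y\<close> the factor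
  with the singularity at \<open>x\<close> stays bounded since \<open>s - x > y - x\<close>. Integrating the factor
  with the singularity at \<open>y\<close> produces the reciprocal of the exponent plus one, and this is the only
  way in which the bound depends on \<open>a\<close> and \<open>b\<close>.
\<close>

lemma nn_Rosenblatt_kernel_bound:
  assumes "-1 < a" "a < 0" "-1 < b" "b < 0" "fst z \<noteq> snd z"
  shows "nn_Rosenblatt_kernel a b z
    \<le> ennreal (max 1 (1 / \<bar>fst z - snd z\<bar>) * (1 + \<bar>fst z\<bar> + \<bar>snd z\<bar>) * (1 / (a + 1) + 1 / (b + 1)))"
proof -
  have *: "nn_Rosenblatt_kernel a b (x, y)
      \<le> ennreal (max 1 (1 / \<bar>x - y\<bar>) * (1 + \<bar>x\<bar> + \<bar>y\<bar>) * (1 / (a + 1) + 1 / (b + 1)))" if "x < y" for x y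
  proof -
    define m where "m = max 1 (1 / \<bar>x - y\<bar>)"
    define w where "w = max 0 (1 - y)"
    have m: "1 \<le> m" by (simp add: m_def)
    have far: "pos_powr (s - x) c \<le> m" if "y < s" "-1 < c" "c < 0" for s c
    proof -
      have "pos_powr (s - x) c = (s - x) powr c" using that \<open>x < y\<close> by (simp add: pos_powr_def)
      also have "\<dots> \<le> (y - x) powr c" using that \<open>x < y\<close> by (intro powr_mono2') auto
      also have "\<dots> \<le> m"
      proof (cases "y - x \<ge> 1")
        case True
        then have "(y - x) powr c \<le> (y - x) powr 0" using that by (intro powr_mono) auto
        then show ?thesis using m True by simp
      next
        case False
        then have "(y - x) powr c \<le> (y - x) powr (-1)" using that \<open>x < y\<close> by (intro powr_mono') auto
        also have "\<dots> = 1 / \<bar>x - y\<bar>" using \<open>x < y\<close> by (simp add: powr_minus_divide)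
        finally show ?thesis by (simp add: m_def)
      qed
      finally show ?thesis .
    qed
    have near: "(\<integral>\<^sup>+s. ennreal (indicator {0..1} s * pos_powr (s - y) c) \<partial>lborel) \<le> ennreal ((1 + \<bar>x\<bar> + \<bar>y\<bar>) * (1 / (c + 1)))"
      if "-1 < c" "c < 0" for c
    proof -
      have "(\<integral>\<^sup>+s. ennreal (indicator {0..1} s * pos_powr (s - y) c) \<partial>lborel)
          = ennreal \<bar>1\<bar> * (\<integral>\<^sup>+u. ennreal (indicator {0..1} (y + 1 * u) * pos_powr (y + 1 * u - y) c) \<partial>lborel)"
        by (intro nn_integral_real_affine) auto
      also have "\<dots> \<le> (\<integral>\<^sup>+u. ennreal (indicator {0..w} u * pos_powr u c) \<partial>lborel)"
        by (simp, intro nn_integral_mono) (auto simp: w_def pos_powr_def split: split_indicator)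
      also have "\<dots> = ennreal (w powr (c + 1) / (c + 1))"
        using that by (intro nn_integral_powr_Icc) (auto simp: w_def)
      also have "\<dots> \<le> ennreal ((1 + \<bar>x\<bar> + \<bar>y\<bar>) * (1 / (c + 1)))"
      proof (rule ennreal_leI)
        have "w powr (c + 1) \<le> (1 + \<bar>y\<bar>) powr (c + 1)"
          using that by (intro powr_mono2) (auto simp: w_def)
        also have "\<dots> \<le> (1 + \<bar>y\<bar>) powr 1" using that by (intro powr_mono) auto
        also have "\<dots> \<le> 1 + \<bar>x\<bar> + \<bar>y\<bar>" by simp
        finally show "w powr (c + 1) / (c + 1) \<le> (1 + \<bar>x\<bar> + \<bar>y\<bar>) * (1 / (c + 1))"
          using that by (simp add: divide_right_mono)
      qed
      finally show ?thesis .
    qed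
    have slice: "Rosenblatt_slice a b s (x, y) \<le> m * (pos_powr (s - y) a + pos_powr (s - y) b)" for s
    proof (cases "y < s")
      case True
      then show ?thesis
        using mult_right_mono[OF far[OF True, of a], of "pos_powr (s - y) b"]
          mult_right_mono[OF far[OF True, of b], of "pos_powr (s - y) a"] assms
        by (simp add: Rosenblatt_slice_def distrib_left)
    qed (simp add: Rosenblatt_slice_def pos_powr_def)
    have "nn_Rosenblatt_kernel a b (x, y)
        \<le> (\<integral>\<^sup>+s. ennreal m * (ennreal (indicator {0..1} s * pos_powr (s - y) a) + ennreal (indicator {0..1} s * pos_powr (s - y) b)) \<partial>lborel)"
      unfolding nn_Rosenblatt_kernel_def
    proof (rule nn_integral_mono)
      fix s :: real
      have "indicator {0..1} s * Rosenblatt_slice a b s (x, y)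
          \<le> m * (indicator {0..1} s * pos_powr (s - y) a + indicator {0..1} s * pos_powr (s - y) b)"
        using slice[of s] by (auto split: split_indicator)
      then have "ennreal (indicator {0..1} s * Rosenblatt_slice a b s (x, y))
          \<le> ennreal (m * (indicator {0..1} s * pos_powr (s - y) a + indicator {0..1} s * pos_powr (s - y) b))"
        by (rule ennreal_leI)
      also have "\<dots> = ennreal m * (ennreal (indicator {0..1} s * pos_powr (s - y) a) + ennreal (indicator {0..1} s * pos_powr (s - y) b))"
        using m by (subst ennreal_mult) (auto simp: ennreal_plus)
      finally show "ennreal (indicator {0..1} s * Rosenblatt_slice a b s (x, y))
         \<le> ennreal m * (ennreal (indicator {0..1} s * pos_powr (s - y) a) + ennreal (indicator {0..1} s * pos_powr (s - y) b))" .
    qed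
    also have "\<dots> = ennreal m * ((\<integral>\<^sup>+s. ennreal (indicator {0..1} s * pos_powr (s - y) a) \<partial>lborel)
         + (\<integral>\<^sup>+s. ennreal (indicator {0..1} s * pos_powr (s - y) b) \<partial>lborel))"
      by (simp add: nn_integral_cmult nn_integral_add)
    also have "\<dots> \<le> ennreal m * (ennreal ((1 + \<bar>x\<bar> + \<bar>y\<bar>) * (1 / (a + 1))) + ennreal ((1 + \<bar>x\<bar> + \<bar>y\<bar>) * (1 / (b + 1))))"
      using assms by (intro mult_left_mono add_mono near) auto
    also have "\<dots> = ennreal (m * (1 + \<bar>x\<bar> + \<bar>y\<bar>) * (1 / (a + 1) + 1 / (b + 1)))"
      using m assms by (simp add: ennreal_mult[symmetric] ennreal_plus[symmetric] distrib_left mult.assoc del: ennreal_plus)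
    finally show ?thesis by (simp add: m_def)
  qed
  obtain x y where z: "z = (x, y)" by (cases z)
  show ?thesis
  proof (cases "x < y")
    case True
    then show ?thesis using * by (simp add: z)
  next
    case False
    then have "y < x" using assms z by simp
    from *[OF this] nn_Rosenblatt_kernel_swap[of a b z] show ?thesis
      by (simp add: z abs_minus_commute add_ac)
  qed
qed

lemma ennreal_Rosenblatt_kernel:
  assumes "-1 < a" "a < 0" "-1 < b" "b < 0" "fst z \<noteq> snd z"
  shows "ennreal (Rosenblatt_kernel a b 1 z) = nn_Rosenblatt_kernel a b z" "0 \<le> Rosenblatt_kernel a b 1 z"
proof -
  obtain x y where z: "z = (x, y)" by (cases z)
  have K: "Rosenblatt_kernel a b 1 z = (LINT s|lborel. indicator {0..1} s * Rosenblatt_slice a b s z)"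
    by (simp add: z Rosenblatt_kernel_def Rosenblatt_slice_def set_lebesgue_integral_def)
  show "0 \<le> Rosenblatt_kernel a b 1 z" unfolding K by (intro Bochner_Integration.integral_nonneg) simp
  have "integrable lborel (\<lambda>s. indicator {0..1} s * Rosenblatt_slice a b s z)"
  proof (rule integrableI_nonneg)
    show "(\<lambda>s. indicator {0..1} s * Rosenblatt_slice a b s z) \<in> borel_measurable lborel"
      unfolding z Rosenblatt_slice_def by measurable
    show "(\<integral>\<^sup>+s. ennreal (indicator {0..1} s * Rosenblatt_slice a b s z) \<partial>lborel) < \<infinity>"
      using nn_Rosenblatt_kernel_bound[OF assms] unfolding nn_Rosenblatt_kernel_def
      by (rule le_less_trans) simp
  qed simp
  then show "ennreal (Rosenblatt_kernel a b 1 z) = nn_Rosenblatt_kernel a b z"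
    unfolding K nn_Rosenblatt_kernel_def by (subst nn_integral_eq_integral) auto
qed

lemma AE_lborel_off_diagonal: "AE z in lborel. fst z \<noteq> (snd z :: real)"
  unfolding lborel_prod[symmetric]
proof (rule lborel_pair.AE_pair_measure)
  show "{z \<in> space (lborel \<Otimes>\<^sub>M lborel). fst z \<noteq> (snd z :: real)} \<in> sets (lborel \<Otimes>\<^sub>M lborel)"
    by measurable
  show "AE x in lborel. AE y in lborel. fst (x, y) \<noteq> (snd (x, y) :: real)"
  proof (rule AE_I2)
    fix x :: real
    show "AE y in lborel. fst (x, y) \<noteq> (snd (x, y) :: real)"
      using AE_lborel_singleton[of x] by eventually_elim simp
  qed
qed

text \<open>
  The kernel is symmetric, so the variance is twice the squared norm; the value \<open>1/2\<close> thus says that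
  the variance at time \<open>1\<close> is \<open>1\<close>.
\<close>

lemma Rosenblatt_kernel_normalised:
  assumes "(a, b) \<in> Rosenblatt_Delta"
  shows "(\<integral>\<^sup>+z. ennreal ((Rosenblatt_A a b / 2 * Rosenblatt_kernel a b 1 z)\<^sup>2) \<partial>lborel) = ennreal (1 / 2)"
proof -
  have ab: "-1 < a" "a < -1/2" "-1 < b" "b < -1/2" "a + b > -3/2"
    using assms by (auto simp: Rosenblatt_Delta_def)
  define D where "D = Beta (a + 1) (- a - b - 1) * Beta (b + 1) (- a - b - 1)
           + Beta (a + 1) (- 2 * a - 1) * Beta (b + 1) (- 2 * b - 1)"
  define N where "N = (a + b + 2) * (2 * (a + b) + 3)"
  note B = Beta_real_pos
  have D: "0 < D" unfolding D_def by (rule add_pos_pos; rule mult_pos_pos; rule B) (use ab in simp_all)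
  have N: "0 < N" using ab unfolding N_def by (intro mult_pos_pos) auto
  have A2: "(Rosenblatt_A a b)\<^sup>2 = N / D"
    using D N unfolding Rosenblatt_A_def D_def[symmetric] N_def[symmetric] by (simp add: power_divide)
  have "(\<integral>\<^sup>+z. ennreal ((Rosenblatt_A a b / 2 * Rosenblatt_kernel a b 1 z)\<^sup>2) \<partial>lborel)
      = (\<integral>\<^sup>+z. ennreal (N / D / 4) * (nn_Rosenblatt_kernel a b z)\<^sup>2 \<partial>lborel)"
  proof (rule nn_integral_cong_AE, use AE_lborel_off_diagonal in eventually_elim)
    case (elim z)
    have "(Rosenblatt_A a b / 2 * Rosenblatt_kernel a b 1 z)\<^sup>2 = N / D / 4 * (Rosenblatt_kernel a b 1 z)\<^sup>2"
      by (simp add: power_mult_distrib power_divide A2)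
    also have "ennreal \<dots> = ennreal (N / D / 4) * (ennreal (Rosenblatt_kernel a b 1 z))\<^sup>2"
    proof -
      have "0 \<le> Rosenblatt_kernel a b 1 z" using ennreal_Rosenblatt_kernel(2)[of a b z] elim ab by simp
      then show ?thesis
        unfolding ennreal_power[OF \<open>0 \<le> Rosenblatt_kernel a b 1 z\<close>] by (intro ennreal_mult) (use D N in simp_all)
    qed
    finally show ?case using ennreal_Rosenblatt_kernel(1)[of a b z] elim ab by simp
  qed
  also have "\<dots> = ennreal (N / D / 4) * ennreal (2 * D / N)"
  proof -
    have [measurable]: "nn_Rosenblatt_kernel a b \<in> borel_measurable borel"
    proof -
      have "(\<lambda>(z, s). ennreal (indicator {0..1} s * Rosenblatt_slice a b s z)) \<in> borel_measurable ((borel \<Otimes>\<^sub>M borel) \<Otimes>\<^sub>M lborel)"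
        by measurable
      then show ?thesis
        unfolding nn_Rosenblatt_kernel_def[abs_def] borel_prod[symmetric]
        by (rule lborel.borel_measurable_nn_integral)
    qed
    show ?thesis
      using nn_integral_Rosenblatt_kernel_square[OF ab]
      by (subst nn_integral_cmult) (auto simp: D_def N_def)
  qed
  also have "\<dots> = ennreal (1 / 2)"
    using D N by (simp add: ennreal_mult[symmetric])
  finally show ?thesis .
qed

section \<open>The normalising constant near the boundary of the parameter region\<close>

lemma Beta_ge_inverse_left:
  assumes "0 < p" "0 < q" "q \<le> (1::real)"
  shows "1 / p \<le> Beta p q"
proof -
  have "Beta p 1 = 1 / p"
  proof -
    have "p \<notin> \<int>\<^sub>\<le>\<^sub>0" using assms by (auto elim!: nonpos_Ints_cases)
    moreover have "Gamma p \<noteq> 0" using Gamma_real_pos[OF assms(1)] by linarith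
    ultimately show ?thesis by (simp add: Beta_def Gamma_plus1)
  qed
  then show ?thesis using Beta_real_mono[of p p q 1] assms by simp
qed

lemma Rosenblatt_A_commute: "Rosenblatt_A b a = Rosenblatt_A a b"
proof -
  have e: "- b - a - 1 = - a - b - 1" by simp
  show ?thesis
    unfolding Rosenblatt_A_def e add.commute[of b a] mult.commute[of "Beta (b + 1) _" "Beta (a + 1) _"] ..
qed

lemma Rosenblatt_A_nonneg:
  assumes "(a, b) \<in> Rosenblatt_Delta"
  shows "0 \<le> Rosenblatt_A a b"
proof -
  note B = Beta_real_pos[THEN less_imp_le]
  show ?thesis
    unfolding Rosenblatt_A_def using assms
    by (intro divide_nonneg_nonneg real_sqrt_ge_zero add_nonneg_nonneg[OF mult_nonneg_nonneg mult_nonneg_nonneg] B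
          mult_nonneg_nonneg) (auto simp: Rosenblatt_Delta_def)
qed

text \<open>
  Only the second product of beta values in the denominator of \<open>A\<close> is kept, with its first factor at
  least \<open>1 / (-2 a - 1)\<close> and its second at least \<open>1 / (b + 1)\<close>.
\<close>

lemma Rosenblatt_A_square_le:
  assumes "(a, b) \<in> Rosenblatt_Delta"
  shows "(Rosenblatt_A a b)\<^sup>2 \<le> 4 * (- 1/2 - a) * (b + 1) * (a + b + 3/2)"
proof -
  have ab: "-1 < a" "a < -1/2" "-1 < b" "b < -1/2" "a + b > -3/2"
    using assms by (auto simp: Rosenblatt_Delta_def)
  define D where "D = Beta (a + 1) (- a - b - 1) * Beta (b + 1) (- a - b - 1)
           + Beta (a + 1) (- 2 * a - 1) * Beta (b + 1) (- 2 * b - 1)"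
  define N where "N = (a + b + 2) * (2 * (a + b) + 3)"
  note B = Beta_real_pos[THEN less_imp_le]
  have b1: "1 / (- 2 * a - 1) \<le> Beta (a + 1) (- 2 * a - 1)"
    using Beta_ge_inverse_left[of "- 2 * a - 1" "a + 1"] ab by (simp add: Beta_commute)
  have b2: "1 / (b + 1) \<le> Beta (b + 1) (- 2 * b - 1)"
    using Beta_ge_inverse_left[of "b + 1" "- 2 * b - 1"] ab by simp
  have "1 / (- 2 * a - 1) * (1 / (b + 1)) \<le> Beta (a + 1) (- 2 * a - 1) * Beta (b + 1) (- 2 * b - 1)"
    using ab by (intro mult_mono b1 b2 B) auto
  also have "\<dots> \<le> D"
    unfolding D_def using ab by (simp add: B)
  finally have D: "1 / ((- 2 * a - 1) * (b + 1)) \<le> D" by simp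
  have pos: "0 < (- 2 * a - 1) * (b + 1)" using ab by (intro mult_pos_pos) auto
  then have D0: "0 < D" using D by (meson less_le_trans zero_less_divide_1_iff)
  have N: "0 \<le> N" "N \<le> 2 * (a + b + 3/2)"
    using ab mult_right_mono[of "a + b + 2" 1 "2 * (a + b) + 3"] by (auto simp: N_def)
  have "(Rosenblatt_A a b)\<^sup>2 = N / D"
    using D0 N unfolding Rosenblatt_A_def D_def[symmetric] N_def[symmetric] by (simp add: power_divide)
  also have "\<dots> \<le> N / (1 / ((- 2 * a - 1) * (b + 1)))"
    using D N pos by (intro divide_left_mono mult_pos_pos) (auto simp: D0)
  also have "\<dots> = N * ((- 2 * a - 1) * (b + 1))" by simp
  also have "\<dots> \<le> 2 * (a + b + 3/2) * ((- 2 * a - 1) * (b + 1))"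
    using N pos by (intro mult_right_mono) auto
  also have "\<dots> = 4 * (- 1/2 - a) * (b + 1) * (a + b + 3/2)" by (simp add: algebra_simps)
  finally show ?thesis .
qed

lemma Rosenblatt_A_square_le_simple:
  assumes "(a, b) \<in> Rosenblatt_Delta"
  shows "(Rosenblatt_A a b)\<^sup>2 \<le> a + b + 3/2" "(Rosenblatt_A a b)\<^sup>2 \<le> - 1/2 - a"
    "(Rosenblatt_A a b)\<^sup>2 \<le> 4 * (- 1/2 - a) * (b + 1)\<^sup>2"
proof -
  have ab: "-1 < a" "a < -1/2" "-1 < b" "b < -1/2" "a + b > -3/2"
    using assms by (auto simp: Rosenblatt_Delta_def)
  note A = Rosenblatt_A_square_le[OF assms]
  have quarter: "4 * x * y * w \<le> w" if "0 \<le> x" "x \<le> 1/2" "0 \<le> y" "y \<le> 1/2" "0 \<le> w" for x y w :: real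
  proof -
    have "x * y \<le> 1/2 * (1/2)" using that by (intro mult_mono) auto
    then have "(4 * (x * y)) * w \<le> 1 * w" using that by (intro mult_right_mono) auto
    then show ?thesis by (simp add: mult.assoc)
  qed
  have "4 * (- 1/2 - a) * (b + 1) * (a + b + 3/2) \<le> a + b + 3/2"
    using ab by (intro quarter) auto
  with A show "(Rosenblatt_A a b)\<^sup>2 \<le> a + b + 3/2" by (rule order_trans)
  have "4 * (- 1/2 - a) * (b + 1) * (a + b + 3/2) = 4 * (b + 1) * (a + b + 3/2) * (- 1/2 - a)"
    by (simp only: mult_ac)
  also have "\<dots> \<le> - 1/2 - a" using ab by (intro quarter) auto
  finally show "(Rosenblatt_A a b)\<^sup>2 \<le> - 1/2 - a" using A by (rule order_trans[rotated])
  have "4 * (- 1/2 - a) * (b + 1) * (a + b + 3/2) \<le> 4 * (- 1/2 - a) * (b + 1) * (b + 1)"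
    using ab by (intro mult_left_mono mult_nonneg_nonneg) auto
  then show "(Rosenblatt_A a b)\<^sup>2 \<le> 4 * (- 1/2 - a) * (b + 1)\<^sup>2"
    using A unfolding power2_eq_square[of "b + 1"] mult.assoc[symmetric] by (rule order_trans[rotated])
qed

lemma tendsto_0_of_square_le:
  fixes f g :: "nat \<Rightarrow> real"
  assumes "\<And>n. (f n)\<^sup>2 \<le> g n" "g \<longlonglongrightarrow> 0"
  shows "f \<longlonglongrightarrow> 0"
proof -
  have "(\<lambda>n. (f n)\<^sup>2) \<longlonglongrightarrow> 0"
    by (rule tendsto_sandwich[OF _ _ tendsto_const assms(2)]) (simp_all add: assms(1))
  from tendsto_real_sqrt[OF this] have "(\<lambda>n. \<bar>f n\<bar>) \<longlonglongrightarrow> 0" by simp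
  then show ?thesis by (rule tendsto_rabs_zero_cancel)
qed

text \<open>
  The square of \<open>A\<close> is bounded by each of \<open>\<gamma>\<^sub>1 + \<gamma>\<^sub>2 + 3/2\<close>, \<open>-1/2 - \<gamma>\<^sub>1\<close> and \<open>-1/2 - \<gamma>\<^sub>2\<close>, which vanish
  on the three sides of the parameter region; this is enough where both exponents stay away from \<open>-1\<close>. At the corner \<open>(-1/2, -1)\<close> the factor \<open>1 / (\<gamma>\<^sub>2 + 1)\<close>
  blows up, and it is compensated by \<open>A\<^sup>2 \<le> 4 (-1/2 - \<gamma>\<^sub>1) (\<gamma>\<^sub>2 + 1)\<^sup>2\<close>.
\<close>

lemma Rosenblatt_A_over_exponents_tendsto_0:
  fixes \<gamma>\<^sub>1 \<gamma>\<^sub>2 :: "nat \<Rightarrow> real"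
  assumes \<Delta>: "\<And>n. (\<gamma>\<^sub>1 n, \<gamma>\<^sub>2 n) \<in> Rosenblatt_Delta"
    and cases: "((\<lambda>n. \<gamma>\<^sub>1 n + \<gamma>\<^sub>2 n) \<longlonglongrightarrow> -3/2 \<and> (\<exists>\<epsilon>>0. \<forall>n. \<gamma>\<^sub>1 n > -1 + \<epsilon> \<and> \<gamma>\<^sub>2 n > -1 + \<epsilon>))
      \<or> (\<gamma>\<^sub>1 \<longlonglongrightarrow> -1/2 \<and> (\<exists>\<gamma>>-1. \<gamma>\<^sub>2 \<longlonglongrightarrow> \<gamma>)) \<or> (\<gamma>\<^sub>2 \<longlonglongrightarrow> -1/2 \<and> (\<exists>\<gamma>>-1. \<gamma>\<^sub>1 \<longlonglongrightarrow> \<gamma>))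
      \<or> (\<gamma>\<^sub>1 \<longlonglongrightarrow> -1/2 \<and> \<gamma>\<^sub>2 \<longlonglongrightarrow> -1)"
  shows "(\<lambda>n. Rosenblatt_A (\<gamma>\<^sub>1 n) (\<gamma>\<^sub>2 n) * (1 / (\<gamma>\<^sub>1 n + 1) + 1 / (\<gamma>\<^sub>2 n + 1))) \<longlonglongrightarrow> 0"
proof -
  define A where "A n = Rosenblatt_A (\<gamma>\<^sub>1 n) (\<gamma>\<^sub>2 n)" for n
  have A_nonneg: "0 \<le> A n" for n unfolding A_def by (rule Rosenblatt_A_nonneg[OF \<Delta>])
  have pos: "0 < \<gamma>\<^sub>1 n + 1" "0 < \<gamma>\<^sub>2 n + 1" for n using \<Delta>[of n] by (auto simp: Rosenblatt_Delta_def)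
  have sq: "(A n)\<^sup>2 \<le> \<gamma>\<^sub>1 n + \<gamma>\<^sub>2 n + 3/2" "(A n)\<^sup>2 \<le> - 1/2 - \<gamma>\<^sub>1 n"
    "(A n)\<^sup>2 \<le> 4 * (- 1/2 - \<gamma>\<^sub>1 n) * (\<gamma>\<^sub>2 n + 1)\<^sup>2" for n
    unfolding A_def by (rule Rosenblatt_A_square_le_simple[OF \<Delta>])+
  have sq2: "(A n)\<^sup>2 \<le> - 1/2 - \<gamma>\<^sub>2 n" for n
  proof -
    have "(\<gamma>\<^sub>2 n, \<gamma>\<^sub>1 n) \<in> Rosenblatt_Delta" using \<Delta>[of n] by (auto simp: Rosenblatt_Delta_def)
    from Rosenblatt_A_square_le_simple(2)[OF this] show ?thesis
      by (simp add: A_def Rosenblatt_A_commute[of "\<gamma>\<^sub>2 n"])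
  qed
  have A1: "A \<longlonglongrightarrow> 0" if "\<gamma>\<^sub>1 \<longlonglongrightarrow> -1/2"
  proof (rule tendsto_0_of_square_le[OF sq(2)])
    have "(\<lambda>n. - 1/2 - \<gamma>\<^sub>1 n) \<longlonglongrightarrow> - 1/2 - (- 1/2)" by (intro tendsto_intros that)
    then show "(\<lambda>n. - 1/2 - \<gamma>\<^sub>1 n) \<longlonglongrightarrow> 0" by simp
  qed
  have A2: "A \<longlonglongrightarrow> 0" if "\<gamma>\<^sub>2 \<longlonglongrightarrow> -1/2"
  proof (rule tendsto_0_of_square_le[OF sq2])
    have "(\<lambda>n. - 1/2 - \<gamma>\<^sub>2 n) \<longlonglongrightarrow> - 1/2 - (- 1/2)" by (intro tendsto_intros that)
    then show "(\<lambda>n. - 1/2 - \<gamma>\<^sub>2 n) \<longlonglongrightarrow> 0" by simp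
  qed
  have quot: "(\<lambda>n. A n * (1 / (\<gamma>\<^sub>1 n + 1) + 1 / (\<gamma>\<^sub>2 n + 1))) \<longlonglongrightarrow> 0"
    if "A \<longlonglongrightarrow> 0" "\<gamma>\<^sub>1 \<longlonglongrightarrow> c" "\<gamma>\<^sub>2 \<longlonglongrightarrow> d" "-1 < c" "-1 < d" for c d
  proof -
    have "(\<lambda>n. A n * (1 / (\<gamma>\<^sub>1 n + 1) + 1 / (\<gamma>\<^sub>2 n + 1))) \<longlonglongrightarrow> 0 * (1 / (c + 1) + 1 / (d + 1))"
      using that by (intro tendsto_intros) auto
    then show ?thesis by simp
  qed
  from cases have "(\<lambda>n. A n * (1 / (\<gamma>\<^sub>1 n + 1) + 1 / (\<gamma>\<^sub>2 n + 1))) \<longlonglongrightarrow> 0"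
  proof (elim disjE conjE exE)
    fix \<epsilon> :: real
    assume s: "(\<lambda>n. \<gamma>\<^sub>1 n + \<gamma>\<^sub>2 n) \<longlonglongrightarrow> -3/2" and \<epsilon>: "0 < \<epsilon>" "\<forall>n. \<gamma>\<^sub>1 n > -1 + \<epsilon> \<and> \<gamma>\<^sub>2 n > -1 + \<epsilon>"
    have "(\<lambda>n. \<gamma>\<^sub>1 n + \<gamma>\<^sub>2 n + 3/2) \<longlonglongrightarrow> -3/2 + 3/2" by (intro tendsto_intros s)
    then have "(\<lambda>n. \<gamma>\<^sub>1 n + \<gamma>\<^sub>2 n + 3/2) \<longlonglongrightarrow> 0" by simp
    from tendsto_0_of_square_le[OF sq(1) this] have "(\<lambda>n. A n * (1 / \<epsilon> + 1 / \<epsilon>)) \<longlonglongrightarrow> 0 * (1 / \<epsilon> + 1 / \<epsilon>)"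
      by (rule tendsto_mult_right)
    then have lim: "(\<lambda>n. A n * (1 / \<epsilon> + 1 / \<epsilon>)) \<longlonglongrightarrow> 0" by simp
    have le: "A n * (1 / (\<gamma>\<^sub>1 n + 1) + 1 / (\<gamma>\<^sub>2 n + 1)) \<le> A n * (1 / \<epsilon> + 1 / \<epsilon>)" for n
    proof -
      have "\<epsilon> \<le> \<gamma>\<^sub>1 n + 1" "\<epsilon> \<le> \<gamma>\<^sub>2 n + 1" using \<epsilon>(2)[rule_format, of n] by linarith+
      then show ?thesis
        by (intro mult_left_mono add_mono frac_le A_nonneg) (use \<epsilon>(1) in simp_all)
    qed
    have ge: "0 \<le> A n * (1 / (\<gamma>\<^sub>1 n + 1) + 1 / (\<gamma>\<^sub>2 n + 1))" for n
      using pos[of n] by (intro mult_nonneg_nonneg A_nonneg add_nonneg_nonneg) auto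
    show ?thesis
      by (rule tendsto_sandwich[OF _ _ tendsto_const lim]) (simp_all only: le ge eventually_True)
  next
    fix \<gamma> :: real assume "\<gamma>\<^sub>1 \<longlonglongrightarrow> -1/2" "-1 < \<gamma>" "\<gamma>\<^sub>2 \<longlonglongrightarrow> \<gamma>"
    then show ?thesis using quot[of "-1/2" \<gamma>] A1 by simp
  next
    fix \<gamma> :: real assume "\<gamma>\<^sub>2 \<longlonglongrightarrow> -1/2" "-1 < \<gamma>" "\<gamma>\<^sub>1 \<longlonglongrightarrow> \<gamma>"
    then show ?thesis using quot[of \<gamma> "-1/2"] A2 by simp
  next
    assume l: "\<gamma>\<^sub>1 \<longlonglongrightarrow> -1/2" "\<gamma>\<^sub>2 \<longlonglongrightarrow> -1"
    have 1: "(\<lambda>n. A n * (1 / (\<gamma>\<^sub>1 n + 1))) \<longlonglongrightarrow> 0 * (1 / (-1/2 + 1))"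
      by (intro tendsto_intros A1 l) simp
    have 2: "(\<lambda>n. A n * (1 / (\<gamma>\<^sub>2 n + 1))) \<longlonglongrightarrow> 0"
    proof (rule tendsto_0_of_square_le)
      show "(A n * (1 / (\<gamma>\<^sub>2 n + 1)))\<^sup>2 \<le> 4 * (- 1/2 - \<gamma>\<^sub>1 n)" for n
        using sq(3)[of n] pos(2)[of n] by (simp add: power_mult_distrib power_divide divide_le_eq)
      have "(\<lambda>n. 4 * (- 1/2 - \<gamma>\<^sub>1 n)) \<longlonglongrightarrow> 4 * (- 1/2 - (- 1/2))" by (intro tendsto_intros l)
      then show "(\<lambda>n. 4 * (- 1/2 - \<gamma>\<^sub>1 n)) \<longlonglongrightarrow> 0" by simp
    qed
    from tendsto_add[OF 1 2] show ?thesis by (simp add: distrib_left)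
  qed
  then show ?thesis by (simp only: A_def)
qed

lemma Rosenblatt_kernel_tendsto_0:
  assumes \<Delta>: "\<And>n. (\<gamma>\<^sub>1 n, \<gamma>\<^sub>2 n) \<in> Rosenblatt_Delta"
    and lim: "(\<lambda>n. Rosenblatt_A (\<gamma>\<^sub>1 n) (\<gamma>\<^sub>2 n) * (1 / (\<gamma>\<^sub>1 n + 1) + 1 / (\<gamma>\<^sub>2 n + 1))) \<longlonglongrightarrow> 0"
    and z: "fst z \<noteq> snd z"
  shows "(\<lambda>n. Rosenblatt_A (\<gamma>\<^sub>1 n) (\<gamma>\<^sub>2 n) / 2 * Rosenblatt_kernel (\<gamma>\<^sub>1 n) (\<gamma>\<^sub>2 n) 1 z) \<longlonglongrightarrow> 0"
proof (rule tendsto_sandwich[of "\<lambda>_. 0"])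
  define C where "C = max 1 (1 / \<bar>fst z - snd z\<bar>) * (1 + \<bar>fst z\<bar> + \<bar>snd z\<bar>)"
  have C: "0 \<le> C" by (simp add: C_def)
  have \<gamma>: "-1 < \<gamma>\<^sub>1 n" "\<gamma>\<^sub>1 n < 0" "-1 < \<gamma>\<^sub>2 n" "\<gamma>\<^sub>2 n < 0" for n
    using \<Delta>[of n] by (auto simp: Rosenblatt_Delta_def)
  have K: "0 \<le> Rosenblatt_kernel (\<gamma>\<^sub>1 n) (\<gamma>\<^sub>2 n) 1 z"
    "Rosenblatt_kernel (\<gamma>\<^sub>1 n) (\<gamma>\<^sub>2 n) 1 z \<le> C * (1 / (\<gamma>\<^sub>1 n + 1) + 1 / (\<gamma>\<^sub>2 n + 1))" for n
  proof -
    show "0 \<le> Rosenblatt_kernel (\<gamma>\<^sub>1 n) (\<gamma>\<^sub>2 n) 1 z" by (rule ennreal_Rosenblatt_kernel(2)[OF \<gamma> z])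
    have r: "0 \<le> 1 / (\<gamma>\<^sub>1 n + 1) + 1 / (\<gamma>\<^sub>2 n + 1)"
      by (rule add_nonneg_nonneg; rule divide_nonneg_nonneg) (use \<gamma>[of n] in simp_all)
    have "ennreal (Rosenblatt_kernel (\<gamma>\<^sub>1 n) (\<gamma>\<^sub>2 n) 1 z) \<le> ennreal (C * (1 / (\<gamma>\<^sub>1 n + 1) + 1 / (\<gamma>\<^sub>2 n + 1)))"
      unfolding ennreal_Rosenblatt_kernel(1)[OF \<gamma> z] C_def by (rule nn_Rosenblatt_kernel_bound[OF \<gamma> z])
    then show "Rosenblatt_kernel (\<gamma>\<^sub>1 n) (\<gamma>\<^sub>2 n) 1 z \<le> C * (1 / (\<gamma>\<^sub>1 n + 1) + 1 / (\<gamma>\<^sub>2 n + 1))"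
      by (rule ennreal_le_iff[THEN iffD1, rotated]) (intro mult_nonneg_nonneg C r)
  qed
  have "(\<lambda>n. C / 2 * (Rosenblatt_A (\<gamma>\<^sub>1 n) (\<gamma>\<^sub>2 n) * (1 / (\<gamma>\<^sub>1 n + 1) + 1 / (\<gamma>\<^sub>2 n + 1)))) \<longlonglongrightarrow> C / 2 * 0"
    by (rule tendsto_mult_left[OF lim])
  then show "(\<lambda>n. C / 2 * (Rosenblatt_A (\<gamma>\<^sub>1 n) (\<gamma>\<^sub>2 n) * (1 / (\<gamma>\<^sub>1 n + 1) + 1 / (\<gamma>\<^sub>2 n + 1)))) \<longlonglongrightarrow> 0"
    by (simp only: mult_zero_right)
  have A: "0 \<le> Rosenblatt_A (\<gamma>\<^sub>1 n) (\<gamma>\<^sub>2 n) / 2" for n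
    using Rosenblatt_A_nonneg[OF \<Delta>[of n]] by simp
  have le: "Rosenblatt_A (\<gamma>\<^sub>1 n) (\<gamma>\<^sub>2 n) / 2 * Rosenblatt_kernel (\<gamma>\<^sub>1 n) (\<gamma>\<^sub>2 n) 1 z
      \<le> C / 2 * (Rosenblatt_A (\<gamma>\<^sub>1 n) (\<gamma>\<^sub>2 n) * (1 / (\<gamma>\<^sub>1 n + 1) + 1 / (\<gamma>\<^sub>2 n + 1)))" for n
    using mult_left_mono[OF K(2) A, of n n] by (simp add: mult_ac)
  show "\<forall>\<^sub>F n in sequentially. Rosenblatt_A (\<gamma>\<^sub>1 n) (\<gamma>\<^sub>2 n) / 2 * Rosenblatt_kernel (\<gamma>\<^sub>1 n) (\<gamma>\<^sub>2 n) 1 z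
      \<le> C / 2 * (Rosenblatt_A (\<gamma>\<^sub>1 n) (\<gamma>\<^sub>2 n) * (1 / (\<gamma>\<^sub>1 n + 1) + 1 / (\<gamma>\<^sub>2 n + 1)))"
    by (intro always_eventually allI le)
  show "\<forall>\<^sub>F n in sequentially. 0 \<le> Rosenblatt_A (\<gamma>\<^sub>1 n) (\<gamma>\<^sub>2 n) / 2 * Rosenblatt_kernel (\<gamma>\<^sub>1 n) (\<gamma>\<^sub>2 n) 1 z"
    by (intro always_eventually allI mult_nonneg_nonneg A K(1))
qed simp

theorem theorem4p1:
  fixes M :: "'a measure"
    and B :: "real set \<Rightarrow> 'a \<Rightarrow> real"
    and \<gamma>\<^sub>1 \<gamma>\<^sub>2 :: "nat \<Rightarrow> real"
    and Z :: "nat \<Rightarrow> real \<Rightarrow> 'a \<Rightarrow> real"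
  assumes "brownian_random_measure M B"
    and "\<And>n. (\<gamma>\<^sub>1 n, \<gamma>\<^sub>2 n) \<in> Rosenblatt_Delta"
    and "\<And>n. generalized_Rosenblatt M B (\<gamma>\<^sub>1 n) (\<gamma>\<^sub>2 n) (Z n)"
    and "((\<lambda>n. \<gamma>\<^sub>1 n + \<gamma>\<^sub>2 n) \<longlonglongrightarrow> -3/2 \<and>
            (\<exists>\<epsilon>>0. \<forall>n. \<gamma>\<^sub>1 n > -1 + \<epsilon> \<and> \<gamma>\<^sub>2 n > -1 + \<epsilon>))
       \<or> (\<exists>\<gamma>. -1 < \<gamma> \<and> \<gamma> < -1/2 \<and>
            ((\<lambda>n. (\<gamma>\<^sub>1 n, \<gamma>\<^sub>2 n)) \<longlonglongrightarrow> (-1/2, \<gamma>) \<or> (\<lambda>n. (\<gamma>\<^sub>1 n, \<gamma>\<^sub>2 n)) \<longlonglongrightarrow> (\<gamma>, -1/2)))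
       \<or> ((\<forall>n. \<gamma>\<^sub>1 n \<ge> \<gamma>\<^sub>2 n) \<and> (\<lambda>n. (\<gamma>\<^sub>1 n, \<gamma>\<^sub>2 n)) \<longlonglongrightarrow> (-1/2, -1) \<and>
            (\<exists>\<rho>\<in>{0..1}. (\<lambda>n. (\<gamma>\<^sub>1 n + \<gamma>\<^sub>2 n + 3/2) / (\<gamma>\<^sub>2 n + 1)) \<longlonglongrightarrow> \<rho>))
       \<or> ((\<forall>n. \<gamma>\<^sub>1 n \<ge> \<gamma>\<^sub>2 n) \<and> (\<lambda>n. (\<gamma>\<^sub>1 n, \<gamma>\<^sub>2 n)) \<longlonglongrightarrow> (-1/2, -1/2) \<and>
            (\<exists>\<rho>\<in>{0..1}. (\<lambda>n. (\<gamma>\<^sub>1 n + 1/2) / (\<gamma>\<^sub>2 n + 1/2)) \<longlonglongrightarrow> \<rho>))"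
  shows "(\<nexists>X :: real \<Rightarrow> 'a \<Rightarrow> real. \<forall>t\<in>{0..1}. tendsto_L2 M (\<lambda>n. Z n t) (X t))
       \<and> (\<nexists>X :: real \<Rightarrow> 'a \<Rightarrow> real. \<forall>t\<in>{0..1}. tendsto_in_prob M (\<lambda>n. Z n t) (X t))"
proof -
  interpret brownian_random_measure M B by fact
  have lim: "(\<lambda>n. Rosenblatt_A (\<gamma>\<^sub>1 n) (\<gamma>\<^sub>2 n) * (1 / (\<gamma>\<^sub>1 n + 1) + 1 / (\<gamma>\<^sub>2 n + 1))) \<longlonglongrightarrow> 0"
  proof (rule Rosenblatt_A_over_exponents_tendsto_0[OF assms(2)])
    have pair: "\<gamma>\<^sub>1 \<longlonglongrightarrow> c \<and> \<gamma>\<^sub>2 \<longlonglongrightarrow> d" if "(\<lambda>n. (\<gamma>\<^sub>1 n, \<gamma>\<^sub>2 n)) \<longlonglongrightarrow> (c, d)" for c d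
      using tendsto_fst[OF that] tendsto_snd[OF that] by simp
    \<comment> \<open>The corner \<open>(-1/2, -1/2)\<close> is covered by the second alternative with \<open>\<gamma> = -1/2\<close>.\<close>
    have half: "-1 < (-1/2 :: real)" by simp
    show "((\<lambda>n. \<gamma>\<^sub>1 n + \<gamma>\<^sub>2 n) \<longlonglongrightarrow> -3/2 \<and> (\<exists>\<epsilon>>0. \<forall>n. \<gamma>\<^sub>1 n > -1 + \<epsilon> \<and> \<gamma>\<^sub>2 n > -1 + \<epsilon>))
      \<or> (\<gamma>\<^sub>1 \<longlonglongrightarrow> -1/2 \<and> (\<exists>\<gamma>>-1. \<gamma>\<^sub>2 \<longlonglongrightarrow> \<gamma>)) \<or> (\<gamma>\<^sub>2 \<longlonglongrightarrow> -1/2 \<and> (\<exists>\<gamma>>-1. \<gamma>\<^sub>1 \<longlonglongrightarrow> \<gamma>))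
      \<or> (\<gamma>\<^sub>1 \<longlonglongrightarrow> -1/2 \<and> \<gamma>\<^sub>2 \<longlonglongrightarrow> -1)"
      using assms(4) pair half by blast
  qed
  have no_prob: False if X: "tendsto_in_prob M (\<lambda>n. Z n 1) X" for X
  proof -
    have "\<exists>Y. has_double_wiener_integral M B (Rosenblatt_kernel (\<gamma>\<^sub>1 n) (\<gamma>\<^sub>2 n) 1) Y \<and>
        (\<forall>\<omega>\<in>space M. Z n 1 \<omega> = Rosenblatt_A (\<gamma>\<^sub>1 n) (\<gamma>\<^sub>2 n) / 2 * Y \<omega>)" for n
      using assms(3)[of n] unfolding generalized_Rosenblatt_def by (elim allE[of _ 1]) simp
    then obtain Y where Y: "\<And>n. has_double_wiener_integral M B (Rosenblatt_kernel (\<gamma>\<^sub>1 n) (\<gamma>\<^sub>2 n) 1) (Y n)"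
      "\<And>n \<omega>. \<omega> \<in> space M \<Longrightarrow> Z n 1 \<omega> = Rosenblatt_A (\<gamma>\<^sub>1 n) (\<gamma>\<^sub>2 n) / 2 * Y n \<omega>"
      by metis
    define F where "F n z = Rosenblatt_A (\<gamma>\<^sub>1 n) (\<gamma>\<^sub>2 n) / 2 * Rosenblatt_kernel (\<gamma>\<^sub>1 n) (\<gamma>\<^sub>2 n) 1 z" for n z
    define W where "W n \<omega> = Rosenblatt_A (\<gamma>\<^sub>1 n) (\<gamma>\<^sub>2 n) / 2 * Y n \<omega>" for n \<omega>
    have FW: "has_double_wiener_integral M B (F n) (W n)" for n
      using has_double_wiener_integral_lincomb[OF Y(1)[of n] Y(1)[of n], of "Rosenblatt_A (\<gamma>\<^sub>1 n) (\<gamma>\<^sub>2 n) / 2" 0]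
      by (simp add: F_def[abs_def] W_def[abs_def])
    have "W n \<in> borel_measurable M" for n
      using FW[of n] by (auto simp: has_double_wiener_integral_def tendsto_L2_def)
    moreover have "{\<omega> \<in> space M. \<bar>W n \<omega> - X \<omega>\<bar> > \<epsilon>} = {\<omega> \<in> space M. \<bar>Z n 1 \<omega> - X \<omega>\<bar> > \<epsilon>}" for n \<epsilon>
      by (intro Collect_cong conj_cong refl) (simp only: W_def Y(2))
    ultimately have "tendsto_in_prob M W X"
      using X by (simp add: tendsto_in_prob_def)
    moreover have "\<not> tendsto_in_prob M W X"
    proof (rule no_limit_in_prob_of_vanishing_kernels[OF FW])
      show "F n (prod.swap z) = F n z" for n z by (simp only: F_def Rosenblatt_kernel_swap)
      show "ennreal (1 / 2) \<le> (\<integral>\<^sup>+z. ennreal ((F n z)\<^sup>2) \<partial>lborel)" for n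
        unfolding F_def Rosenblatt_kernel_normalised[OF assms(2)] ..
      show "AE z in lborel. (\<lambda>n. F n z) \<longlonglongrightarrow> 0"
        using AE_lborel_off_diagonal unfolding F_def
        by eventually_elim (rule Rosenblatt_kernel_tendsto_0[OF assms(2) lim])
    qed simp
    ultimately show False by contradiction
  qed
  have "\<nexists>X. \<forall>t\<in>{0..1}. tendsto_in_prob M (\<lambda>n. Z n t) (X t)"
  proof
    assume "\<exists>X. \<forall>t\<in>{0..1}. tendsto_in_prob M (\<lambda>n. Z n t) (X t)"
    then obtain X where "\<forall>t\<in>{0..1}. tendsto_in_prob M (\<lambda>n. Z n t) (X t)" ..
    then have "tendsto_in_prob M (\<lambda>n. Z n 1) (X 1)" by simp
    then show False by (rule no_prob)
  qed
  moreover have "\<nexists>X. \<forall>t\<in>{0..1}. tendsto_L2 M (\<lambda>n. Z n t) (X t)"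
  proof
    assume "\<exists>X. \<forall>t\<in>{0..1}. tendsto_L2 M (\<lambda>n. Z n t) (X t)"
    then obtain X where "\<forall>t\<in>{0..1}. tendsto_L2 M (\<lambda>n. Z n t) (X t)" ..
    then have "tendsto_L2 M (\<lambda>n. Z n 1) (X 1)" by simp
    then show False by (intro no_prob) (rule tendsto_L2_imp_tendsto_in_prob[OF _ finite_measure_axioms])
  qed
  ultimately show ?thesis by blast
qed

end
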